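(* If $q$ is an odd prime power and $k=q^{2}-q+1$, then $$c_{k}>\frac{1}{2\sqrt{k-1}+1}\quad\text{and}\quad c_{-k+1}>\frac{1}{2\sqrt{k-1}+1}.$$
   Context: Graphs are finite, simple and undirected; the order of a graph is its number of vertices. For a graph $G$ of order $n$, $\lambda_1(G)\ge\cdots\ge\lambda_n(G)$ denote the eigenvalues of its adjacency matrix, with multiplicity. For an integer $j\ge1$, $$c_{j}=\sup\{\lambda_{j}(G)/n: G\text{ is a graph of order }n\ge j\},\qquad c_{-j}=\sup\{|\lambda_{n-j+1}(G)|/n: G\text{ is a graph of order }n\ge j\}.$$ Thus $c_{-k+1}$ means $c_{-j}$ with $j=k-1$. *)

theory Defs
  imports
    "Jordan_Normal_Form.Char_Poly"
    "HOL-Number_Theory.Prime_Powers"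
begin

(* Up to isomorphism, a finite simple graph of order n has vertex set {0..<n};
   edges are two-element sets of vertices. *)
definition simple_graph :: "nat \<Rightarrow> nat set set \<Rightarrow> bool" where
  "simple_graph n E \<longleftrightarrow> (\<forall>e\<in>E. e \<subseteq> {0..<n} \<and> card e = 2)"

definition adj_mat :: "nat \<Rightarrow> nat set set \<Rightarrow> real mat" where
  "adj_mat n E = mat n n (\<lambda>(u, v). if {u, v} \<in> E then 1 else 0)"

(* The j-th largest eigenvalue, j = 1, ..., n, counted with multiplicity as a root of the
   characteristic polynomial. As the adjacency matrix is real symmetric, all n roots are real,
   so the list below has length n. *)
definition graph_eigenvalue :: "nat \<Rightarrow> nat set set \<Rightarrow> nat \<Rightarrow> real" where
  "graph_eigenvalue n E j =
     rev (sorted_list_of_multiset (proots (char_poly (adj_mat n E)))) ! (j - 1)"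

(* The constants c_j for nonzero integers j; the value at 0 is irrelevant. Both suprema are
   over nonempty sets of reals bounded by 1, since all eigenvalues of a graph of order n have
   absolute value at most n. *)
definition eig_const :: "int \<Rightarrow> real" where
  "eig_const i =
     (if i > 0
      then let j = nat i
           in Sup {graph_eigenvalue n E j / real n | n E. simple_graph n E \<and> j \<le> n}
      else let j = nat (- i)
           in Sup {\<bar>graph_eigenvalue n E (n - j + 1)\<bar> / real n | n E. simple_graph n E \<and> j \<le> n})"

end

theory Submission
  imports Defs "Jordan_Normal_Form.Spectral_Radius" "HOL-Algebra.Algebraic_Closure"
    "HOL-Number_Theory.Residues"
begin

text \<open>Both bounds come from one matrix: the Seidel matrix \<open>S\<close> of the unitary two-graph. Its order is
  \<open>n = q\<^sup>3 + 1\<close>, it is symmetric with zero diagonal and entries \<open>\<plusminus>1\<close> elsewhere, and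
  \<open>S\<^sup>2 = (q\<^sup>2 - q) S + q\<^sup>3 I\<close>. So its eigenvalues are \<open>q\<^sup>2\<close> and \<open>- q\<close>, and as its trace vanishes, \<open>q\<^sup>2\<close> has
  multiplicity exactly \<open>k = q\<^sup>2 - q + 1\<close>. Write \<open>J\<close> for the all-ones matrix.

  For the smallest eigenvalues, \<open>(J - S - I) / 2\<close> is the adjacency matrix of a graph. On the vectors of the
  \<open>k\<close>-dimensional eigenspace of \<open>S\<close> that are orthogonal to the all-ones vector it acts as
  \<open>- (q\<^sup>2 + 1) / 2\<close>, so at least \<open>k - 1\<close> of its eigenvalues are at most that.
  For the largest eigenvalues, \<open>(J + S + I) / 2\<close> has ones on the diagonal, and its quadratic form is
  at least \<open>(q\<^sup>2 + 1) / 2\<close> on the whole eigenspace because \<open>J\<close> is positive semidefinite. Replacing each vertex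
  by a clique of size \<open>4\<close> and removing the loops gives a graph of order \<open>4 n\<close> whose \<open>k\<close>-th eigenvalue is at
  least \<open>2 (q\<^sup>2 + 1) - 1\<close>. Both constants are therefore at least \<open>(2 q\<^sup>2 + 1) / (4 (q\<^sup>3 + 1))\<close>, which
  exceeds \<open>1 / (2 sqrt (k - 1) + 1)\<close> (lemma \<open>eigenvalue_ratio_exceeds\<close>).

  The matrix \<open>S\<close> is built from the isotropic points of a Hermitian form \<open>H\<close> in three variables over the field
  with \<open>q\<^sup>2\<close> elements: its entries are the values of the quadratic character at \<open>H x y\<close>, up to one global
  sign. These are symmetric because \<open>H y x\<close> is the conjugate of \<open>H x y\<close>, and the
  quadratic character does not change under conjugation. The formula for \<open>S\<^sup>2\<close> is a
  character sum, evaluated by means of two kinds of isometries: translations, which fix one isotropic point and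
  are transitive on the others, and an inversion that moves the fixed point.

  The linear algebra consists of the spectral theorem for real symmetric matrices, which also makes the
  suprema in question finite, and the easy half of the Courant-Fischer principle
  (lemma \<open>count_eigenvalues_ge\<close>).\<close>
hide_const (open) Divisibility.prime


section \<open>Existence of finite fields\<close>
lemma (in cring) binomial_theorem:
  assumes x: "x \<in> carrier R" and y: "y \<in> carrier R"
  shows "(x \<oplus> y) [^] (n::nat) = (\<Oplus>k\<in>{..n}. [(n choose k)] \<cdot> (x [^] k \<otimes> y [^] (n - k)))"
proof (induction n)
  case 0
  show ?case using x y by simp
next
  case (Suc n)
  let ?t = "\<lambda>n k. [(n choose k)] \<cdot> (x [^] k \<otimes> y [^] (n - k))"
  let ?A = "\<lambda>k. [(n choose k)] \<cdot> (x [^] Suc k \<otimes> y [^] (n - k))"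
  let ?B = "\<lambda>k. [(n choose k)] \<cdot> (x [^] k \<otimes> y [^] (Suc n - k))"
  have "(x \<oplus> y) [^] Suc n = (\<Oplus>k\<in>{..n}. ?t n k) \<otimes> (x \<oplus> y)"
    using Suc by simp
  also have "\<dots> = (\<Oplus>k\<in>{..n}. ?t n k \<otimes> x) \<oplus> (\<Oplus>k\<in>{..n}. ?t n k \<otimes> y)"
    using x y by (simp add: r_distr finsum_ldistr Pi_def)
  also have "(\<Oplus>k\<in>{..n}. ?t n k \<otimes> x) = (\<Oplus>k\<in>{..n}. ?A k)"
    using x y by (intro finsum_cong') (auto simp: add_pow_ldistr add_pow_rdistr m_ac)
  also have "(\<Oplus>k\<in>{..n}. ?t n k \<otimes> y) = (\<Oplus>k\<in>{..n}. ?B k)"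
    using x y by (intro finsum_cong') (auto simp: add_pow_ldistr add_pow_rdistr m_ac Suc_diff_le)
  also have "(\<Oplus>k\<in>{..n}. ?B k) = (\<Oplus>k\<in>{..Suc n}. ?B k)"
    using x y by (simp add: finsum_Suc Pi_def binomial_eq_0)
  also have "\<dots> = (\<Oplus>k\<in>{..n}. ?B (Suc k)) \<oplus> ?B 0"
    using x y by (subst finsum_Suc2) (auto simp: Pi_def)
  also have "(\<Oplus>k\<in>{..n}. ?A k) \<oplus> ((\<Oplus>k\<in>{..n}. ?B (Suc k)) \<oplus> ?B 0)
     = (\<Oplus>k\<in>{..n}. ?A k \<oplus> ?B (Suc k)) \<oplus> ?B 0"
    using x y by (simp add: finsum_addf Pi_def a_assoc)
  also have "(\<Oplus>k\<in>{..n}. ?A k \<oplus> ?B (Suc k)) = (\<Oplus>k\<in>{..n}. ?t (Suc n) (Suc k))"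
    using x y by (intro finsum_cong') (auto simp: add.nat_pow_mult)
  also have "?B 0 = ?t (Suc n) 0"
    by simp
  also have "(\<Oplus>k\<in>{..n}. ?t (Suc n) (Suc k)) \<oplus> ?t (Suc n) 0 = (\<Oplus>k\<in>{..Suc n}. ?t (Suc n) k)"
    using x y finsum_Suc2[of "?t (Suc n)" n] by (simp add: Pi_def)
  finally show ?case .
qed

lemma (in cring) add_pow_char_multiple:
  assumes char: "[p] \<cdot> \<one> = \<zero>" and dvd: "(p::nat) dvd m" and x: "x \<in> carrier R"
  shows "[m] \<cdot> x = \<zero>"
proof -
  obtain l where m: "m = p * l" using dvd by blast
  have "[m] \<cdot> x = [l] \<cdot> ([p] \<cdot> (\<one> \<otimes> x))"
    using x by (simp add: m add.nat_pow_pow)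
  also have "[p] \<cdot> (\<one> \<otimes> x) = ([p] \<cdot> \<one>) \<otimes> x"
    using add_pow_ldistr[of \<one> x p] x by simp
  finally show ?thesis using x char by simp
qed

lemma (in cring) frobenius_add:
  assumes p: "prime (p::nat)" and char: "[p] \<cdot> \<one> = \<zero>"
    and x: "x \<in> carrier R" and y: "y \<in> carrier R"
  shows "(x \<oplus> y) [^] (p ^ m) = x [^] (p ^ m) \<oplus> y [^] (p ^ m)"
proof (induction m)
  case 0
  show ?case using x y by (simp del: One_nat_def)
next
  case (Suc m)
  have step: "(u \<oplus> v) [^] p = u [^] p \<oplus> v [^] p" if u: "u \<in> carrier R" and v: "v \<in> carrier R" for u v
  proof -
    let ?f = "\<lambda>k. [(p choose k)] \<cdot> (u [^] k \<otimes> v [^] (p - k))"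
    have p0: "p \<noteq> 0" using p by auto
    have "(u \<oplus> v) [^] p = (\<Oplus>k\<in>{..p}. ?f k)"
      by (rule binomial_theorem[OF u v])
    also have "\<dots> = (\<Oplus>k\<in>{0, p}. ?f k)"
    proof (rule add.finprod_mono_neutral_cong_right)
      show "{0, p} \<subseteq> {..p}" by auto
      show "?f i = \<zero>" if "i \<in> {..p} - {0, p}" for i
      proof -
        from that have "p dvd (p choose i)" using p by (intro dvd_choose_prime) auto
        thus "?f i = \<zero>" using u v by (intro add_pow_char_multiple[OF char]) auto
      qed
    qed (use u v in auto)
    also have "\<dots> = u [^] p \<oplus> v [^] p"
      using u v p0 by (subst add.finprod_insert) (auto simp: a_comm)
    finally show ?thesis .
  qed
  have "(x \<oplus> y) [^] (p ^ Suc m) = ((x \<oplus> y) [^] (p ^ m)) [^] p"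
    using x y by (simp add: nat_pow_pow mult.commute)
  also have "\<dots> = (x [^] (p ^ m)) [^] p \<oplus> (y [^] (p ^ m)) [^] p"
    using x y by (simp add: Suc.IH step)
  finally show ?case using x y by (simp add: nat_pow_pow mult.commute)
qed

lemma ring_hom_add_pow_one:
  assumes "h \<in> ring_hom R S" "ring R" "ring S" "[(p::nat)] \<cdot>\<^bsub>R\<^esub> \<one>\<^bsub>R\<^esub> = \<zero>\<^bsub>R\<^esub>"
  shows "[p] \<cdot>\<^bsub>S\<^esub> \<one>\<^bsub>S\<^esub> = \<zero>\<^bsub>S\<^esub>"
proof -
  interpret ring_hom_ring R S h using assms by (intro ring_hom_ringI2)
  have "h ([n] \<cdot>\<^bsub>R\<^esub> \<one>\<^bsub>R\<^esub>) = [n] \<cdot>\<^bsub>S\<^esub> \<one>\<^bsub>S\<^esub>" for n :: nat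
    by (induction n) (auto simp: R.add.nat_pow_Suc S.add.nat_pow_Suc)
  thus ?thesis using assms(4) by (metis hom_zero)
qed

text \<open>The polynomial \<open>X\<^sup>N - X\<close> with \<open>N = p\<^sup>m\<close> splits, so only multiple roots could make the number of its
  roots smaller than \<open>N\<close>. With \<open>Y = X - a\<close> for a root \<open>a\<close>, additivity of the Frobenius map in the polynomial
  ring gives \<open>X\<^sup>N - X = Y\<^sup>N - Y\<close>, and this is not divisible by \<open>Y\<^sup>2\<close>.\<close>
lemma (in algebraically_closed) card_roots_frobenius_power:
  assumes p: "prime (p::nat)" and char: "[p] \<cdot> \<one> = \<zero>" and m: "m > 0"
  shows "card {x \<in> carrier L. x [^] (p ^ m) = x} = p ^ m"
proof -
  define N where "N = p ^ m"
  have N: "N \<ge> 2"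
    using prime_ge_2_nat[OF p] m unfolding N_def
    by (metis One_nat_def Suc_leI dual_order.trans power_increasing power_one_right prime_gt_0_nat[OF p])
  define U where "U = poly_ring L"
  interpret UP: domain U
    unfolding U_def using univ_poly_is_domain[OF carrier_is_subring] .
  have X: "X \<in> carrier U" unfolding U_def by (rule var_closed[OF carrier_is_subring])
  define P where "P = X [^]\<^bsub>U\<^esub> N \<ominus>\<^bsub>U\<^esub> X"
  have P: "P \<in> carrier U" unfolding P_def using X by auto
  have emb: "poly_of_const \<in> ring_hom L U"
    using canonical_embedding_is_hom[OF carrier_is_subring] unfolding U_def by simp
  have charU: "[p] \<cdot>\<^bsub>U\<^esub> \<one>\<^bsub>U\<^esub> = \<zero>\<^bsub>U\<^esub>"
    using ring_hom_add_pow_one[OF emb] ring_axioms UP.ring_axioms char by blast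
  have degY: "degree ([\<one>, \<ominus> a] [^]\<^bsub>U\<^esub> (n::nat)) = n" if "a \<in> carrier L" for a n
  proof -
    have "[\<one>, \<ominus> a] \<in> carrier U"
      using that unfolding U_def sym[OF univ_poly_carrier] polynomial_def by auto
    thus ?thesis unfolding U_def using polynomial_pow_degree by simp
  qed
  have degP: "degree P = N"
  proof -
    have "X = [\<one>, \<ominus> \<zero>]" by (simp add: var_def)
    hence d: "degree (X [^]\<^bsub>U\<^esub> N) = N" using degY[of \<zero> N] by simp
    have mX: "\<ominus>\<^bsub>U\<^esub> X \<in> carrier U" using X by simp
    have d': "degree (\<ominus>\<^bsub>U\<^esub> X) = 1"
      using univ_poly_a_inv_length[OF carrier_is_subring, of X] X unfolding U_def
      by (simp add: var_def)
    have "degree (X [^]\<^bsub>U\<^esub> N \<oplus>\<^bsub>U\<^esub> (\<ominus>\<^bsub>U\<^esub> X)) = max N 1"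
      using poly_add_degree_eq[OF carrier_is_subring, of "X [^]\<^bsub>U\<^esub> N" "\<ominus>\<^bsub>U\<^esub> X"]
        N d d' UP.nat_pow_closed[OF X, of N] mX
      unfolding U_def univ_poly_carrier univ_poly_add
      by (simp del: poly_add.simps)
    thus ?thesis using N unfolding P_def a_minus_def by simp
  qed
  have P0: "P \<noteq> []" using degP N by auto
  have evalP: "eval P a = a [^] N \<ominus> a" if a: "a \<in> carrier L" for a
  proof -
    interpret E: ring_hom_cring U L "\<lambda>p. eval p a"
      unfolding U_def by (rule eval_cring_hom[OF carrier_is_subring a])
    show ?thesis unfolding P_def
      using X a eval_var[OF a] by (simp add: a_minus_def E.hom_pow)
  qed
  have simple: "alg_mult P a \<le> 1" if a: "a \<in> carrier L" and root: "a [^] N = a" for a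
  proof (rule ccontr)
    assume "\<not> alg_mult P a \<le> 1"
    hence two: "([\<one>, \<ominus> a] [^]\<^bsub>U\<^esub> (2::nat)) pdivides P"
      using le_alg_mult_imp_pdivides[of a P 2] a P unfolding U_def by simp
    define Y where "Y = [\<one>, \<ominus> a]"
    have Y: "Y \<in> carrier U"
      using a unfolding Y_def U_def sym[OF univ_poly_carrier] polynomial_def by auto
    define A where "A = poly_of_const a"
    have A: "A \<in> carrier U" unfolding A_def using ring_hom_memE(1)[OF emb a] .
    have XYA: "X = Y \<oplus>\<^bsub>U\<^esub> A"
      using a by (auto simp: U_def univ_poly_add Y_def A_def var_def poly_of_const_def l_neg)
    interpret C: ring_hom_ring L U poly_of_const
      using emb ring_axioms UP.ring_axioms by (intro ring_hom_ringI2)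
    have cancel: "B = ((B \<oplus>\<^bsub>U\<^esub> A) \<ominus>\<^bsub>U\<^esub> (Y \<oplus>\<^bsub>U\<^esub> A)) \<oplus>\<^bsub>U\<^esub> Y" if "B \<in> carrier U" for B
      using that A Y UP.a_comm[OF Y A]
      by (simp add: a_minus_def UP.minus_add UP.a_assoc UP.r_neg2 UP.l_neg)
    have "A [^]\<^bsub>U\<^esub> N = A"
      unfolding A_def using a root C.hom_nat_pow[OF a, of N] by simp
    moreover have "X [^]\<^bsub>U\<^esub> N = Y [^]\<^bsub>U\<^esub> N \<oplus>\<^bsub>U\<^esub> A [^]\<^bsub>U\<^esub> N"
      unfolding XYA N_def using UP.frobenius_add[OF p charU Y A] .
    ultimately have PY: "Y [^]\<^bsub>U\<^esub> N = P \<oplus>\<^bsub>U\<^esub> Y"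
      using cancel[OF UP.nat_pow_closed[OF Y, of N]] unfolding P_def by (simp add: XYA)
    obtain g where g: "g \<in> carrier U" "P = Y [^]\<^bsub>U\<^esub> (2::nat) \<otimes>\<^bsub>U\<^esub> g"
      using two unfolding pdivides_def Y_def[symmetric] U_def[symmetric] by auto
    have "Y [^]\<^bsub>U\<^esub> N = Y [^]\<^bsub>U\<^esub> (2::nat) \<otimes>\<^bsub>U\<^esub> Y [^]\<^bsub>U\<^esub> (N - 2)"
      using N UP.nat_pow_mult[OF Y, of 2 "N - 2"] by (metis le_add_diff_inverse)
    moreover have "u = s \<otimes>\<^bsub>U\<^esub> (t \<ominus>\<^bsub>U\<^esub> g)"
      if "s \<otimes>\<^bsub>U\<^esub> t = s \<otimes>\<^bsub>U\<^esub> g \<oplus>\<^bsub>U\<^esub> u" "s \<in> carrier U" "t \<in> carrier U" "u \<in> carrier U"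
      for s t u
    proof -
      have "s \<otimes>\<^bsub>U\<^esub> (t \<ominus>\<^bsub>U\<^esub> g) = s \<otimes>\<^bsub>U\<^esub> t \<ominus>\<^bsub>U\<^esub> s \<otimes>\<^bsub>U\<^esub> g"
        using that g by algebra
      also have "\<dots> = u"
        unfolding that(1) using that g by algebra
      finally show ?thesis by simp
    qed
    ultimately have "Y = Y [^]\<^bsub>U\<^esub> (2::nat) \<otimes>\<^bsub>U\<^esub> (Y [^]\<^bsub>U\<^esub> (N - 2) \<ominus>\<^bsub>U\<^esub> g)"
      using PY g Y UP.nat_pow_closed[OF Y] by metis
    moreover have "Y [^]\<^bsub>U\<^esub> (N - 2) \<ominus>\<^bsub>U\<^esub> g \<in> carrier U" using Y g by simp
    ultimately have "(Y [^]\<^bsub>U\<^esub> (2::nat)) pdivides Y"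
      unfolding pdivides_def U_def[symmetric] by (auto intro!: dividesI)
    hence "degree (Y [^]\<^bsub>U\<^esub> (2::nat)) \<le> degree Y"
      using pdivides_imp_degree_le[OF carrier_is_subring, of "Y [^]\<^bsub>U\<^esub> (2::nat)" Y]
        Y UP.nat_pow_closed[OF Y, of 2]
      unfolding U_def by (simp add: Y_def)
    thus False using degY[OF a, of 2] by (simp add: Y_def)
  qed
  have mem: "x \<in># roots P \<longleftrightarrow> x \<in> carrier L \<and> x [^] N = x" for x
    using roots_mem_iff_is_root[of P x] P P0 evalP[of x] r_right_minus_eq[of "x [^] N" x]
    unfolding U_def is_root_def by (auto simp: eq_commute[of \<zero>])
  have "roots P = mset_set (set_mset (roots P))"
  proof (rule multiset_eqI)
    fix x
    show "count (roots P) x = count (mset_set (set_mset (roots P))) x"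
    proof (cases "x \<in># roots P")
      case True
      hence "count (roots P) x \<le> 1"
        using simple[of x] mem alg_mult_eq_count_roots[of P] P unfolding U_def by simp
      with True show ?thesis by (simp add: le_antisym)
    next
      case False thus ?thesis by (simp add: not_in_iff)
    qed
  qed
  hence "card (set_mset (roots P)) = size (roots P)"
    by (metis size_mset_set)
  also have "\<dots> = N"
    using roots_over_carrier[of P] P degP unfolding U_def splitted_def by simp
  also have "set_mset (roots P) = {x \<in> carrier L. x [^] N = x}"
    using mem by auto
  finally show ?thesis by (simp add: N_def)
qed

text \<open>The field is the set of fixed points of the \<open>m\<close>-th iterate of the Frobenius map in an algebraic closure of the
  field with \<open>p\<close> elements.\<close>
theorem finite_field_exists:
  assumes p: "prime p" and m: "m > 0"
  obtains R :: "((int list \<times> nat) multiset \<Rightarrow> int) ring"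
  where "field R" and "finite (carrier R)" and "card (carrier R) = p ^ m"
    and "[p] \<cdot>\<^bsub>R\<^esub> \<one>\<^bsub>R\<^esub> = \<zero>\<^bsub>R\<^esub>"
proof -
  have p1: "int p > 1" using prime_gt_1_nat[OF p] by simp
  interpret Z: field "residue_ring (int p)"
    by (rule residues_prime.is_field[OF residues_prime.intro[OF p]])
  obtain L :: "((int list \<times> nat) multiset \<Rightarrow> int) ring"
    where L: "algebraic_closure L (Z.indexed_const ` (carrier (residue_ring (int p))))"
      and hom: "Z.indexed_const \<in> ring_hom (residue_ring (int p)) L"
    by (rule Z.exists_closure)
  interpret L: algebraic_closure L "Z.indexed_const ` (carrier (residue_ring (int p)))" by (rule L)
  have Zpow: "[n] \<cdot>\<^bsub>residue_ring (int p)\<^esub> \<one>\<^bsub>residue_ring (int p)\<^esub> = int n mod int p" for n :: nat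
    using p1 by (induction n) (auto simp: residue_ring_def add_pow_def nat_pow_def mod_simps add.commute)
  have char: "[p] \<cdot>\<^bsub>L\<^esub> \<one>\<^bsub>L\<^esub> = \<zero>\<^bsub>L\<^esub>"
    using ring_hom_add_pow_one[OF hom Z.ring_axioms L.ring_axioms] Zpow[of p] by (simp add: residue_ring_def)
  define F where "F = {x \<in> carrier L. x [^]\<^bsub>L\<^esub> (p ^ m) = x}"
  have cardF: "card F = p ^ m"
    unfolding F_def using L.card_roots_frobenius_power[OF p char m] .
  have pm: "p ^ m > 0" using p by (simp add: prime_gt_0_nat)
  have finF: "finite F" using cardF pm card_ge_0_finite by metis
  have sum: "x \<oplus>\<^bsub>L\<^esub> y \<in> F" if "x \<in> F" "y \<in> F" for x y
    using that L.frobenius_add[OF p char, of x y m] by (auto simp: F_def)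
  have zero: "\<zero>\<^bsub>L\<^esub> \<in> F" using pm by (auto simp: F_def L.nat_pow_zero)
  have neg: "\<ominus>\<^bsub>L\<^esub> x \<in> F" if "x \<in> F" for x
  proof -
    have x: "x \<in> carrier L" "x [^]\<^bsub>L\<^esub> (p ^ m) = x" using that by (auto simp: F_def)
    have "(x \<oplus>\<^bsub>L\<^esub> \<ominus>\<^bsub>L\<^esub> x) [^]\<^bsub>L\<^esub> (p ^ m) = x \<oplus>\<^bsub>L\<^esub> (\<ominus>\<^bsub>L\<^esub> x) [^]\<^bsub>L\<^esub> (p ^ m)"
      using L.frobenius_add[OF p char, of x "\<ominus>\<^bsub>L\<^esub> x" m] x by simp
    hence "x \<oplus>\<^bsub>L\<^esub> (\<ominus>\<^bsub>L\<^esub> x) [^]\<^bsub>L\<^esub> (p ^ m) = \<zero>\<^bsub>L\<^esub>"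
      using x pm by (simp add: L.r_neg L.nat_pow_zero)
    hence "(\<ominus>\<^bsub>L\<^esub> x) [^]\<^bsub>L\<^esub> (p ^ m) = \<ominus>\<^bsub>L\<^esub> x"
      using x by (metis L.a_comm L.a_inv_closed L.minus_equality L.nat_pow_closed)
    thus ?thesis using x by (simp add: F_def)
  qed
  have sub: "subring F L"
    by (rule L.subringI) (use sum neg in \<open>auto simp: F_def L.nat_pow_distrib\<close>)
  have "subfield F L"
  proof (rule L.subfieldI'[OF sub])
    fix k assume k: "k \<in> F - {\<zero>\<^bsub>L\<^esub>}"
    hence ku: "k \<in> Units L" and kc: "k \<in> carrier L" and kp: "k [^]\<^bsub>L\<^esub> (p ^ m) = k"
      using L.field_Units by (auto simp: F_def)
    have "(inv\<^bsub>L\<^esub> k) [^]\<^bsub>L\<^esub> (p ^ m) \<otimes>\<^bsub>L\<^esub> k = (inv\<^bsub>L\<^esub> k \<otimes>\<^bsub>L\<^esub> k) [^]\<^bsub>L\<^esub> (p ^ m)"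
      using ku kc kp by (simp add: L.nat_pow_distrib del: L.Units_l_inv)
    also have "\<dots> = \<one>\<^bsub>L\<^esub>" using ku by simp
    finally have "(inv\<^bsub>L\<^esub> k) [^]\<^bsub>L\<^esub> (p ^ m) = inv\<^bsub>L\<^esub> k"
      using ku kc by (metis L.comm_inv_char L.Units_inv_closed L.m_comm L.nat_pow_closed)
    thus "inv\<^bsub>L\<^esub> k \<in> F" using ku by (simp add: F_def)
  qed
  hence fld: "field (L\<lparr>carrier := F\<rparr>)" using L.subfield_iff(2) by blast
  have "[n] \<cdot>\<^bsub>L\<lparr>carrier := F\<rparr>\<^esub> \<one>\<^bsub>L\<lparr>carrier := F\<rparr>\<^esub> = [n] \<cdot>\<^bsub>L\<^esub> \<one>\<^bsub>L\<^esub>" for n :: nat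
    by (simp add: add_pow_def nat_pow_def)
  thus ?thesis using that[of "L\<lparr>carrier := F\<rparr>"] fld cardF finF char by simp
qed

section \<open>Norm, trace and quadratic character of a field of odd square order\<close>

text \<open>The order of the field is \<open>q\<^sup>2\<close>, and \<open>x \<mapsto> x\<^sup>q\<close> plays the role of complex conjugation. Its
  additivity is an assumption because it comes from the characteristic, which is not mentioned here.\<close>
locale odd_square_field = field R for R (structure) +
  fixes q :: nat
  assumes finite_carrier: "finite (carrier R)"
    and card_carrier: "card (carrier R) = q\<^sup>2"
    and odd_q: "odd q" and q_gt_1: "q > 1"
    and frobenius: "\<And>x y. x \<in> carrier R \<Longrightarrow> y \<in> carrier R \<Longrightarrow>
                      (x \<oplus> y) [^] q = x [^] q \<oplus> y [^] q"
begin

lemma pow_carrier_order: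
  assumes "x \<in> carrier R" "x \<noteq> \<zero>"
  shows "x [^] (q\<^sup>2 - 1) = \<one>"
proof -
  interpret G: group "Multiplicative_Group.mult_of R" by (rule field_mult_group)
  have "x [^]\<^bsub>Multiplicative_Group.mult_of R\<^esub> order (Multiplicative_Group.mult_of R) = \<one>\<^bsub>Multiplicative_Group.mult_of R\<^esub>"
    using assms by (intro G.pow_order_eq_1) simp
  moreover have "order (Multiplicative_Group.mult_of R) = q\<^sup>2 - 1"
    using order_mult_of[OF finite_carrier] card_carrier by (simp add: order_def)
  ultimately show ?thesis
    by (simp only: Multiplicative_Group.nat_pow_mult_of Multiplicative_Group.one_mult_of)
qed

text \<open>In the multiplicative group every nonempty fibre of \<open>x \<mapsto> x\<^sup>e\<close> has at most \<open>e\<close> elements, and the image lies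
  among the at most \<open>d\<close> roots of \<open>t\<^sup>d = 1\<close>. Since the group has \<open>d e\<close> elements, equality holds throughout.
  This one count yields the number of squares, of elements of trace zero and of elements of a given norm.\<close>
lemma card_power_fibre:
  assumes de: "d * e = q\<^sup>2 - 1" and t: "t \<in> carrier R" "t [^] d = \<one>"
  shows "card {x \<in> carrier R. x [^] e = t} = e"
proof (rule ccontr)
  have "q\<^sup>2 > 1\<^sup>2" using q_gt_1 by (intro power_strict_mono) auto
  hence pos: "d > 0" "e > 0" using de by (auto intro!: Nat.gr0I)
  define \<mu> where "\<mu> = {t \<in> carrier R. t [^] d = \<one>}"
  define fib where "fib = (\<lambda>t. {x \<in> carrier R. x [^] e = t})"
  have fin: "finite \<mu>" "finite (fib s)" for s
    unfolding \<mu>_def fib_def using finite_carrier by auto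
  have card\<mu>: "card \<mu> \<le> d"
    unfolding \<mu>_def using num_roots_le_deg[OF finite_carrier] pos by simp
  have nz: "x \<noteq> \<zero>" if "x \<in> fib s" "s \<in> \<mu>" for x s
    using that pos by (auto simp: fib_def \<mu>_def nat_pow_zero)
  have cardfib: "card (fib s) \<le> e" if s: "s \<in> \<mu>" for s
  proof (cases "fib s = {}")
    case False
    then obtain y where y: "y \<in> fib s" by auto
    have yu: "y \<in> Units R" using nz[OF y s] y field_Units by (auto simp: fib_def)
    have yc: "y \<in> carrier R" "inv y \<in> carrier R" using yu by auto
    have "card (fib s) \<le> card {x \<in> carrier R. x [^] e = \<one>}"
    proof (rule card_inj_on_le[where f = "\<lambda>x. inv y \<otimes> x"])
      show "inj_on (\<lambda>x. inv y \<otimes> x) (fib s)"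
        using yu yc by (intro inj_onI) (metis (no_types, lifting) Units_inv_Units Units_l_cancel fib_def mem_Collect_eq)
      show "(\<lambda>x. inv y \<otimes> x) ` fib s \<subseteq> {x \<in> carrier R. x [^] e = \<one>}"
      proof safe
        fix x assume x: "x \<in> fib s"
        show "inv y \<otimes> x \<in> carrier R" using x yc by (auto simp: fib_def)
        have "(inv y \<otimes> x) [^] e = (inv y) [^] e \<otimes> y [^] e"
          using x y yc by (auto simp: fib_def nat_pow_distrib)
        also have "\<dots> = (inv y \<otimes> y) [^] e" using yc by (simp add: nat_pow_distrib)
        also have "\<dots> = \<one>" using yu by simp
        finally show "(inv y \<otimes> x) [^] e = \<one>" .
      qed
    qed (use finite_carrier in auto)
    also have "\<dots> \<le> e" using num_roots_le_deg[OF finite_carrier] pos by simp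
    finally show ?thesis .
  qed auto
  assume "card {x \<in> carrier R. x [^] e = t} \<noteq> e"
  moreover have tm: "t \<in> \<mu>" using t by (simp add: \<mu>_def)
  ultimately have less: "card (fib t) < e" using cardfib[of t] by (simp add: fib_def)
  have "carrier R - {\<zero>} \<subseteq> (\<Union>s\<in>\<mu>. fib s)"
  proof
    fix x assume x: "x \<in> carrier R - {\<zero>}"
    have "(x [^] e) [^] d = \<one>"
      using x pow_carrier_order[of x] de by (simp add: nat_pow_pow mult.commute)
    thus "x \<in> (\<Union>s\<in>\<mu>. fib s)" using x by (auto simp: \<mu>_def fib_def)
  qed
  hence "card (carrier R - {\<zero>}) \<le> card (\<Union>s\<in>\<mu>. fib s)"
    using fin by (intro card_mono) auto
  also have "\<dots> \<le> (\<Sum>s\<in>\<mu>. card (fib s))" by (rule card_UN_le[OF fin(1)])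
  also have "\<dots> < (\<Sum>s\<in>\<mu>. e)"
    by (rule sum_strict_mono_ex1) (use fin cardfib less tm in auto)
  also have "\<dots> \<le> d * e" using card\<mu> by simp
  also have "\<dots> = card (carrier R - {\<zero>})"
    using de card_carrier by (simp add: finite_carrier)
  finally show False by simp
qed

definition half :: nat where "half = (q\<^sup>2 - 1) div 2"

lemma two_half: "2 * half = q\<^sup>2 - 1"
  unfolding half_def using odd_q by simp

lemma half_pos: "half > 0"
proof -
  have "q\<^sup>2 > 1\<^sup>2" using q_gt_1 by (intro power_strict_mono) auto
  thus ?thesis using two_half by (intro Nat.gr0I) auto
qed

lemma pow_half:
  assumes "x \<in> carrier R" "x \<noteq> \<zero>"
  shows "x [^] half = \<one> \<or> x [^] half = \<ominus> \<one>"
proof -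
  have "(x [^] half) \<otimes> (x [^] half) = \<one>"
    using assms pow_carrier_order[OF assms] two_half
    by (simp add: nat_pow_mult mult_2)
  thus ?thesis using assms by (intro square_eq_one) auto
qed

lemma card_squares: "card {x \<in> carrier R. x [^] half = \<one>} = half"
  by (rule card_power_fibre[of 2]) (use two_half in auto)

lemma one_neq_minus_one: "\<one> \<noteq> \<ominus> \<one>"
proof
  assume "\<one> = \<ominus> \<one>"
  hence "carrier R - {\<zero>} \<subseteq> {x \<in> carrier R. x [^] half = \<one>}"
    using pow_half by auto
  hence "card (carrier R - {\<zero>}) \<le> card {x \<in> carrier R. x [^] half = \<one>}"
    using finite_carrier by (intro card_mono) auto
  hence "q\<^sup>2 - 1 \<le> half" using card_squares card_carrier by (simp add: finite_carrier)
  thus False using two_half half_pos by simp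
qed

text \<open>The quadratic character, by Euler's criterion.\<close>
definition qchar :: "'a \<Rightarrow> int" where
  "qchar x = (if x = \<zero> then 0 else if x [^] half = \<one> then 1 else - 1)"

lemma qchar_zero [simp]: "qchar \<zero> = 0"
  by (simp add: qchar_def)

lemma qchar_one [simp]: "qchar \<one> = 1"
  by (simp add: qchar_def)

lemma qchar_mult:
  assumes x: "x \<in> carrier R" and y: "y \<in> carrier R"
  shows "qchar (x \<otimes> y) = qchar x * qchar y"
proof (cases "x = \<zero> \<or> y = \<zero>")
  case True
  thus ?thesis using x y by auto
next
  case False
  have "(x \<otimes> y) [^] half = x [^] half \<otimes> y [^] half"
    using x y by (simp add: nat_pow_distrib)
  moreover have "\<ominus> \<one> \<otimes> \<ominus> \<one> = \<one>" by (simp add: l_minus)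
  ultimately show ?thesis
    using False x y pow_half[of x] pow_half[of y] one_neq_minus_one integral[of x y]
    by (auto simp: qchar_def)
qed

lemma qchar_square:
  assumes "x \<in> carrier R" "x \<noteq> \<zero>"
  shows "qchar x * qchar x = 1"
  using assms by (simp add: qchar_def)

lemma sum_qchar: "(\<Sum>x\<in>carrier R. qchar x) = 0"
proof -
  let ?S = "{x \<in> carrier R. x [^] half = \<one>}"
  let ?N = "{x \<in> carrier R. x \<noteq> \<zero> \<and> x [^] half \<noteq> \<one>}"
  have z: "\<zero> \<notin> ?S" using half_pos by (auto simp: nat_pow_zero)
  have split: "carrier R = insert \<zero> (?S \<union> ?N)" by auto
  have fin: "finite ?S" "finite ?N" using finite_carrier by auto
  have "q\<^sup>2 = Suc (card ?S + card ?N)"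
    unfolding card_carrier[symmetric]
    by (subst split, subst card_insert_disjoint)
       (use z fin in \<open>auto intro!: card_Un_disjoint\<close>)
  hence N: "card ?N = half" using card_squares two_half half_pos by simp
  have "(\<Sum>x\<in>carrier R. qchar x) = (\<Sum>x\<in>?S \<union> ?N. qchar x)"
    by (subst split, subst sum.insert) (use z fin in auto)
  also have "\<dots> = (\<Sum>x\<in>?S. qchar x) + (\<Sum>x\<in>?N. qchar x)"
    by (rule sum.union_disjoint) (use fin in auto)
  also have "(\<Sum>x\<in>?S. qchar x) = (\<Sum>x\<in>?S. 1)"
    by (rule sum.cong) (use z in \<open>auto simp: qchar_def\<close>)
  also have "(\<Sum>x\<in>?N. qchar x) = (\<Sum>x\<in>?N. - 1)"
    by (rule sum.cong) (auto simp: qchar_def)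
  finally show ?thesis using N card_squares by simp
qed

definition frob :: "'a \<Rightarrow> 'a" where "frob x = x [^] q"

lemma frob_closed [simp]: "x \<in> carrier R \<Longrightarrow> frob x \<in> carrier R"
  by (simp add: frob_def)

lemma frob_add: "x \<in> carrier R \<Longrightarrow> y \<in> carrier R \<Longrightarrow> frob (x \<oplus> y) = frob x \<oplus> frob y"
  by (simp add: frob_def frobenius)

lemma frob_mult: "x \<in> carrier R \<Longrightarrow> y \<in> carrier R \<Longrightarrow> frob (x \<otimes> y) = frob x \<otimes> frob y"
  by (simp add: frob_def nat_pow_distrib)

lemma frob_zero [simp]: "frob \<zero> = \<zero>"
  using q_gt_1 by (simp add: frob_def nat_pow_zero)

lemma frob_one [simp]: "frob \<one> = \<one>"
  by (simp add: frob_def)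

lemma frob_minus: "x \<in> carrier R \<Longrightarrow> frob (\<ominus> x) = \<ominus> frob x"
  using frob_add[of x "\<ominus> x"] by (metis a_inv_closed frob_closed frob_zero minus_equality minus_minus r_neg a_comm)

lemma frob_frob [simp]:
  assumes "x \<in> carrier R" shows "frob (frob x) = x"
proof (cases "x = \<zero>")
  case False
  have "q\<^sup>2 = Suc (q\<^sup>2 - 1)" using q_gt_1 by simp
  hence "x [^] (q\<^sup>2) = x [^] (q\<^sup>2 - 1) \<otimes> x" by (metis nat_pow_Suc)
  thus ?thesis using assms False pow_carrier_order[of x]
    by (simp add: frob_def nat_pow_pow power2_eq_square)
qed simp

lemma frob_eq_zero_iff: "x \<in> carrier R \<Longrightarrow> frob x = \<zero> \<longleftrightarrow> x = \<zero>"
  by (metis frob_frob frob_zero)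

lemma frob_inv:
  assumes "x \<in> carrier R" "x \<noteq> \<zero>" shows "frob (inv x) = inv (frob x)"
proof -
  have u: "x \<in> Units R" using assms field_Units by auto
  have "frob (inv x) \<otimes> frob x = \<one>"
    using u by (metis Units_closed Units_inv_closed Units_l_inv frob_mult frob_one)
  thus ?thesis using u by (metis Units_closed Units_inv_closed frob_closed comm_inv_char m_comm)
qed

text \<open>This makes the Seidel matrix symmetric although the Hermitian form is not.\<close>
lemma qchar_frob:
  assumes "x \<in> carrier R" shows "qchar (frob x) = qchar x"
proof -
  have "(frob x) [^] half = (x [^] half) [^] q"
    using assms by (simp add: frob_def nat_pow_pow mult.commute)
  hence e: "(frob x) [^] half = frob (x [^] half)" by (simp add: frob_def)
  have "(frob x) [^] half = \<one> \<longleftrightarrow> x [^] half = \<one>"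
    unfolding e using assms by (metis frob_frob frob_one nat_pow_closed)
  thus ?thesis using assms by (simp add: qchar_def frob_eq_zero_iff)
qed

lemma qchar_inv:
  assumes "x \<in> carrier R" "x \<noteq> \<zero>" shows "qchar (inv x) = qchar x"
proof -
  have u: "x \<in> Units R" using assms field_Units by auto
  have "qchar (inv x) * qchar x = 1"
    using u by (metis Units_closed Units_inv_closed Units_l_inv qchar_mult qchar_one)
  moreover have "qchar x = 1 \<or> qchar x = -1" using assms by (auto simp: qchar_def)
  ultimately show ?thesis by auto
qed

lemma pow_pred_mult: "x \<in> carrier R \<Longrightarrow> x [^] (q - 1) \<otimes> x = frob x"
  using nat_pow_Suc[of x "q - 1"] q_gt_1 by (simp add: frob_def)

definition trace_zero :: "'a set" where
  "trace_zero = {c \<in> carrier R. c \<oplus> frob c = \<zero>}"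

lemma factor_card: "(q + 1) * (q - 1) = q\<^sup>2 - 1" "(q - 1) * (q + 1) = q\<^sup>2 - 1"
  using q_gt_1 by (cases q; simp add: power2_eq_square)+

text \<open>For \<open>c \<noteq> 0\<close> the condition \<open>c + c\<^sup>q = 0\<close> says \<open>c\<^bsup>q-1\<^esup> = - 1\<close>, to which \<open>card_power_fibre\<close> applies.\<close>
lemma trace_zero_iff:
  assumes "c \<in> carrier R" "c \<noteq> \<zero>"
  shows "c \<in> trace_zero \<longleftrightarrow> c [^] (q - 1) = \<ominus> \<one>"
proof -
  have "c \<in> trace_zero \<longleftrightarrow> frob c = \<ominus> \<one> \<otimes> c"
  proof -
    have "c \<oplus> frob c = \<zero> \<longleftrightarrow> frob c = \<ominus> c"
      using assms by (metis a_comm frob_closed minus_equality r_neg)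
    thus ?thesis using assms by (simp add: trace_zero_def l_minus)
  qed
  also have "\<dots> \<longleftrightarrow> c [^] (q - 1) = \<ominus> \<one>"
    unfolding pow_pred_mult[OF assms(1), symmetric] using assms by (simp add: m_rcancel)
  finally show ?thesis .
qed

lemma minus_one_pow_even: "(\<ominus> \<one>) [^] (2 * n :: nat) = \<one>"
proof -
  have "(\<ominus> \<one>) [^] (2::nat) = \<one>"
    by (simp add: numeral_2_eq_2 l_minus)
  hence "((\<ominus> \<one>) [^] (2::nat)) [^] n = \<one>" by simp
  thus ?thesis by (simp only: nat_pow_pow a_inv_closed one_closed)
qed

lemma card_trace_zero: "card trace_zero = q"
proof -
  have "\<ominus> \<one> \<noteq> \<zero>"
    by (metis minus_minus minus_zero one_closed one_not_zero)
  moreover have "\<zero> [^] (q - 1) = \<zero>" using q_gt_1 by (simp add: nat_pow_zero)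
  ultimately have p: "\<zero> [^] (q - 1) \<noteq> \<ominus> \<one>" by metis
  have m: "(\<ominus> \<one>) [^] (q + 1) = \<one>"
    using minus_one_pow_even[of "(q + 1) div 2"] odd_q by simp
  have "trace_zero = insert \<zero> {c \<in> carrier R. c [^] (q - 1) = \<ominus> \<one>}" (is "_ = insert _ ?C")
  proof (rule Set.set_eqI)
    fix c
    have z: "\<zero> \<in> trace_zero" by (simp add: trace_zero_def)
    have "trace_zero \<subseteq> carrier R" by (auto simp: trace_zero_def)
    thus "c \<in> trace_zero \<longleftrightarrow> c \<in> insert \<zero> ?C"
      using trace_zero_iff[of c] z by blast
  qed
  moreover have "card {c \<in> carrier R. c [^] (q - 1) = \<ominus> \<one>} = q - 1"
    by (rule card_power_fibre[OF factor_card(1)]) (use m in auto)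
  ultimately show ?thesis using p q_gt_1 finite_carrier by simp
qed

text \<open>The quadratic character is constant on the nonzero elements of trace zero. The opposite of that constant is the
  global sign that has to be given to the Seidel matrix for its eigenvalue of absolute value \<open>q\<^sup>2\<close> to be
  positive for every \<open>q\<close>.\<close>
definition two_graph_sign :: int where "two_graph_sign = (if even ((q + 1) div 2) then - 1 else 1)"

text \<open>The exponent \<open>(q\<^sup>2 - 1) / 2\<close> of Euler's criterion factors as \<open>(q - 1) ((q + 1) / 2)\<close>, and the \<open>(q - 1)\<close>-th
  power of such an element is \<open>- 1\<close>.\<close>
lemma qchar_trace_zero:
  assumes c: "c \<in> trace_zero" "c \<noteq> \<zero>"
  shows "qchar c = - two_graph_sign"
proof -
  have cc: "c \<in> carrier R" using c by (simp add: trace_zero_def)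
  have "half = (q - 1) * ((q + 1) div 2)"
    using odd_q two_half factor_card by (metis div_mult_swap even_add half_def odd_one dvd_def
        nonzero_mult_div_cancel_left)
  hence "c [^] half = (\<ominus> \<one>) [^] ((q + 1) div 2)"
    using trace_zero_iff[OF cc c(2)] c cc by (simp add: nat_pow_pow[symmetric])
  moreover have "(\<ominus> \<one>) [^] n = (if even n then \<one> else \<ominus> \<one>)" for n :: nat
    by (auto elim!: evenE oddE simp: minus_one_pow_even)
  ultimately show ?thesis
    using c one_neq_minus_one by (auto simp: qchar_def two_graph_sign_def)
qed


section \<open>The Hermitian unital and its two-graph\<close>

text \<open>In suitable coordinates the Hermitian form on triples is
  \<open>u\<^sub>0 v\<^sub>2\<^sup>q + u\<^sub>1 v\<^sub>1\<^sup>q + u\<^sub>2 v\<^sub>0\<^sup>q\<close>. Up to scalars the isotropic vectors are \<open>(1, 0, 0)\<close>, the point at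
  infinity, and the vectors \<open>(c, b, 1)\<close> with \<open>c + b b\<^sup>q + c\<^sup>q = 0\<close>, represented here by the pair \<open>(b, c)\<close>.
  The form takes the value \<open>1\<close> between the point at infinity and an affine point.\<close>
definition points :: "('a \<times> 'a) set" where
  "points = {(b, c). b \<in> carrier R \<and> c \<in> carrier R \<and> c \<oplus> b \<otimes> frob b \<oplus> frob c = \<zero>}"

definition herm :: "'a \<times> 'a \<Rightarrow> 'a \<times> 'a \<Rightarrow> 'a" where
  "herm z w = snd z \<oplus> fst z \<otimes> frob (fst w) \<oplus> frob (snd w)"

lemma points_closed:
  "z \<in> points \<Longrightarrow> fst z \<in> carrier R" "z \<in> points \<Longrightarrow> snd z \<in> carrier R"
  by (auto simp: points_def)

lemma finite_points: "finite points"
  by (rule finite_subset[of _ "carrier R \<times> carrier R"]) (auto simp: points_def finite_carrier)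

lemma points_iff: "z \<in> points \<longleftrightarrow> fst z \<in> carrier R \<and> snd z \<in> carrier R \<and> herm z z = \<zero>"
  by (auto simp: points_def herm_def split: prod.splits)

lemma herm_closed: "z \<in> points \<Longrightarrow> w \<in> points \<Longrightarrow> herm z w \<in> carrier R"
  by (simp add: herm_def points_closed)

lemma herm_swap:
  assumes "z \<in> points" "w \<in> points" shows "herm w z = frob (herm z w)"
  using assms by (simp add: herm_def points_closed frob_add frob_mult a_ac m_comm)

text \<open>The possible first coordinates over \<open>c\<close> are the elements of norm \<open>- (c + c\<^sup>q)\<close>: only \<open>0\<close> if this norm
  vanishes, and \<open>q + 1\<close> elements otherwise, because the norm then lies in the subfield with \<open>q\<close> elements.\<close>
lemma card_points_over:
  assumes c: "c \<in> carrier R"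
  shows "card {b. (b, c) \<in> points} = (if c \<in> trace_zero then 1 else q + 1)"
proof -
  define t where "t = \<ominus> (c \<oplus> frob c)"
  have tc: "t \<in> carrier R" using c by (simp add: t_def)
  have eq: "{b. (b, c) \<in> points} = {b \<in> carrier R. b [^] (q + 1) = t}"
  proof -
    have "c \<oplus> b \<otimes> frob b \<oplus> frob c = \<zero> \<longleftrightarrow> b [^] (q + 1) = t" if b: "b \<in> carrier R" for b
    proof -
      have "b \<otimes> frob b = b [^] (q + 1)" using b by (simp add: frob_def m_comm)
      moreover have "c \<oplus> b \<otimes> frob b \<oplus> frob c = b \<otimes> frob b \<oplus> (c \<oplus> frob c)"
        using b c by (simp add: a_ac)
      moreover have "b \<otimes> frob b \<oplus> (c \<oplus> frob c) = \<zero> \<longleftrightarrow> b \<otimes> frob b = t"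
        unfolding t_def using b c
        by (metis a_closed frob_closed l_neg m_closed minus_equality)
      ultimately show ?thesis by simp
    qed
    thus ?thesis using c by (auto simp: points_def)
  qed
  show ?thesis
  proof (cases "c \<in> trace_zero")
    case True
    hence "t = \<zero>" by (simp add: t_def trace_zero_def)
    moreover have "b [^] (q + 1) = \<zero> \<longleftrightarrow> b = \<zero>" if b: "b \<in> carrier R" for b
    proof -
      have "b [^] (q + 1) = frob b \<otimes> b" by (simp add: frob_def)
      thus ?thesis using b by (simp add: integral_iff frob_eq_zero_iff)
    qed
    ultimately have "{b. (b, c) \<in> points} = {\<zero>}" unfolding eq by auto
    thus ?thesis using True by simp
  next
    case False
    hence t0: "t \<noteq> \<zero>" using c unfolding t_def trace_zero_def
      by (metis (mono_tags, lifting) a_closed frob_closed mem_Collect_eq minus_minus minus_zero)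
    have "frob t = t" using c by (simp add: t_def frob_minus frob_add a_comm)
    hence "t [^] (q - 1) \<otimes> t = \<one> \<otimes> t" using pow_pred_mult[OF tc] tc by simp
    hence "t [^] (q - 1) = \<one>" using t0 tc m_rcancel[of t "t [^] (q - 1)" \<one>] by simp
    hence "card {b \<in> carrier R. b [^] (q + 1) = t} = q + 1"
      using card_power_fibre[OF factor_card(2)] tc by blast
    thus ?thesis using False eq by simp
  qed
qed

lemma sum_points_snd:
  fixes f :: "'a \<Rightarrow> int"
  shows "(\<Sum>z\<in>points. f (snd z)) =
    (int q + 1) * (\<Sum>c\<in>carrier R. f c) - int q * (\<Sum>c\<in>trace_zero. f c)"
proof -
  have sub: "trace_zero \<subseteq> carrier R" by (auto simp: trace_zero_def)
  have finb: "finite {b. (b, c) \<in> points}" for c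
    by (rule finite_subset[of _ "carrier R"]) (auto simp: points_def finite_carrier)
  have "(\<Sum>z\<in>points. f (snd z)) = (\<Sum>z\<in>(SIGMA c:carrier R. {b. (b, c) \<in> points}). f (fst z))"
    by (rule sum.reindex_bij_witness[of _ prod.swap prod.swap]) (auto simp: points_def)
  also have "\<dots> = (\<Sum>c\<in>carrier R. \<Sum>b\<in>{b. (b, c) \<in> points}. f c)"
    by (subst sum.Sigma) (auto simp: finite_carrier finb case_prod_beta)
  also have "\<dots> = (\<Sum>c\<in>carrier R. (int q + 1) * f c - (if c \<in> trace_zero then int q * f c else 0))"
    by (rule sum.cong) (auto simp: card_points_over algebra_simps)
  also have "\<dots> = (int q + 1) * (\<Sum>c\<in>carrier R. f c) - (\<Sum>c\<in>trace_zero. int q * f c)"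
    using sub finite_carrier
    by (simp add: sum_subtractf sum_distrib_left sum.If_cases Int_absorb1)
  finally show ?thesis by (simp add: sum_distrib_left)
qed

lemma card_points: "card points = q ^ 3"
proof -
  have "int (card points) = (\<Sum>z\<in>points. 1)" by simp
  also have "\<dots> = (int q + 1) * (int q)\<^sup>2 - int q * int q"
    using sum_points_snd[of "\<lambda>_. 1"] by (simp add: card_carrier card_trace_zero)
  also have "\<dots> = int (q ^ 3)" by (simp add: power2_eq_square power3_eq_cube algebra_simps)
  finally show ?thesis by linarith
qed

text \<open>The character sums to zero over the whole field, so only the correction from the elements of trace zero, on
  which the character is constant, contributes.\<close>
lemma sum_qchar_points: "(\<Sum>z\<in>points. qchar (snd z)) = two_graph_sign * (int q ^ 2 - int q)"
proof -
  have fin: "finite trace_zero" using finite_carrier by (simp add: trace_zero_def)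
  have z: "\<zero> \<in> trace_zero" by (simp add: trace_zero_def)
  have "(\<Sum>c\<in>trace_zero. qchar c) = (\<Sum>c\<in>trace_zero - {\<zero>}. qchar c)"
    using fin z by (simp add: sum.remove)
  also have "\<dots> = (\<Sum>c\<in>trace_zero - {\<zero>}. - two_graph_sign)"
    by (rule sum.cong) (auto simp: qchar_trace_zero)
  also have "\<dots> = - two_graph_sign * (int q - 1)"
    using z fin card_trace_zero q_gt_1 by (simp add: of_nat_diff)
  finally have T: "(\<Sum>c\<in>trace_zero. qchar c) = - two_graph_sign * (int q - 1)" .
  show ?thesis
    unfolding sum_points_snd sum_qchar T by (simp add: power2_eq_square algebra_simps)
qed

text \<open>This is the isometry that fixes the point at infinity and moves \<open>w\<close> to the origin, that is, the action of an
  element of the Heisenberg group. Its second coordinate is a value of the form, so sums of the character of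
  \<open>herm z w\<close> over \<open>z\<close> become sums over second coordinates.\<close>
definition translate :: "'a \<times> 'a \<Rightarrow> 'a \<times> 'a \<Rightarrow> 'a \<times> 'a" where
  "translate w z = (fst z \<ominus> fst w, herm z w)"

lemma herm_translate:
  assumes w: "w \<in> points" and x: "x \<in> points" and z: "z \<in> points"
  shows "herm (translate w x) (translate w z) = herm x z"
proof -
  define b c where "b = fst w" and "c = snd w"
  define d where "d = fst x \<ominus> b"
  define e where "e = fst z \<ominus> b"
  have [simp]: "b \<in> carrier R" "c \<in> carrier R" "d \<in> carrier R" "e \<in> carrier R"
      "snd x \<in> carrier R" "snd z \<in> carrier R" "frob c \<in> carrier R" "frob b \<in> carrier R"
    using w x z by (auto simp: b_def c_def d_def e_def points_closed)
  \<comment> \<open>Expressing the first coordinates by the differences \<open>d\<close> and \<open>e\<close> keeps the computation free of subtraction.\<close>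
  have fx: "fst x = d \<oplus> b" and fz: "fst z = e \<oplus> b"
    using w x z by (auto simp: d_def e_def b_def points_closed a_minus_def a_assoc l_neg)
  have iso: "c \<oplus> (b \<otimes> frob b \<oplus> frob c) = \<zero>"
    using w by (auto simp: points_def b_def c_def a_assoc)
  have "herm (translate w x) (translate w z) =
      (snd x \<oplus> (d \<oplus> b) \<otimes> frob b \<oplus> frob c) \<oplus> d \<otimes> frob e
        \<oplus> frob (snd z \<oplus> (e \<oplus> b) \<otimes> frob b \<oplus> frob c)"
    by (simp add: herm_def translate_def fx fz b_def[symmetric] c_def[symmetric]
        d_def[symmetric, unfolded fx] e_def[symmetric, unfolded fz])
  also have "\<dots> = (snd x \<oplus> (d \<oplus> b) \<otimes> frob (e \<oplus> b) \<oplus> frob (snd z)) \<oplus> (c \<oplus> (b \<otimes> frob b \<oplus> frob c))"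
    by (simp add: frob_add frob_mult l_distr r_distr a_ac m_comm)
  also have "\<dots> = herm x z"
    unfolding iso by (simp add: herm_def fx fz)
  finally show ?thesis .
qed

lemma translate_points:
  assumes "w \<in> points" "z \<in> points" shows "translate w z \<in> points"
proof -
  have "fst (translate w z) \<in> carrier R" "snd (translate w z) \<in> carrier R"
    using assms by (simp_all add: translate_def points_closed herm_closed)
  moreover have "herm (translate w z) (translate w z) = \<zero>"
    using assms herm_translate[of w z z] points_iff by simp
  ultimately show ?thesis by (simp add: points_iff)
qed

text \<open>Two distinct isotropic points are never orthogonal: after moving one of them to the origin, the second
  coordinate of the other vanishes, hence so do the norm of its first coordinate and that coordinate itself. Hence the off-diagonal entries of the Seidel matrix are nonzero.\<close>
lemma herm_eq_zero:
  assumes w: "w \<in> points" and z: "z \<in> points" and "herm z w = \<zero>"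
  shows "z = w"
proof -
  have cl: "fst z \<in> carrier R" "snd z \<in> carrier R" "fst w \<in> carrier R" "snd w \<in> carrier R"
    using w z by (auto simp: points_closed)
  have "herm (translate w z) (translate w z) = \<zero>"
    using translate_points[OF w z] by (simp add: points_iff)
  hence "(fst z \<ominus> fst w) \<otimes> frob (fst z \<ominus> fst w) = \<zero>"
    using cl assms(3) by (simp add: translate_def herm_def[of "(_, _)" "(_, _)"])
  hence "fst z \<ominus> fst w = \<zero>"
    using cl by (simp add: integral_iff frob_eq_zero_iff)
  hence f: "fst z = fst w" using cl by simp
  have "snd z \<oplus> (fst w \<otimes> frob (fst w) \<oplus> frob (snd w)) = snd w \<oplus> (fst w \<otimes> frob (fst w) \<oplus> frob (snd w))"
    using w assms(3) f cl by (simp add: points_iff herm_def a_assoc)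
  hence "snd z = snd w" using cl by (simp add: add.r_cancel)
  with f show ?thesis by (simp add: prod_eq_iff)
qed

lemma bij_translate:
  assumes w: "w \<in> points" shows "bij_betw (translate w) points points"
proof -
  have "inj_on (translate w) points"
  proof (rule inj_onI)
    fix z z' assume z: "z \<in> points" and z': "z' \<in> points" and eq: "translate w z = translate w z'"
    have "herm z z' = herm (translate w z) (translate w z')"
      using herm_translate[OF w z z'] by simp
    also have "\<dots> = \<zero>" using translate_points[OF w z'] eq by (simp add: points_iff)
    finally show "z = z'" by (rule herm_eq_zero[OF z' z])
  qed
  thus ?thesis
    using endo_inj_surj[OF finite_points, of "translate w"] translate_points[OF w]
    unfolding bij_betw_def by blast
qed

lemma sum_qchar_herm:
  assumes w: "w \<in> points"
  shows "(\<Sum>z\<in>points. qchar (herm z w)) = two_graph_sign * (int q ^ 2 - int q)"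
  unfolding sum_qchar_points[symmetric]
  using sum.reindex_bij_betw[OF bij_translate[OF w], of "\<lambda>z. qchar (snd z)"]
  by (simp add: translate_def)


definition origin :: "'a \<times> 'a" where "origin = (\<zero>, \<zero>)"

lemma origin_point: "origin \<in> points"
  by (simp add: origin_def points_def)

lemma herm_origin: "z \<in> points \<Longrightarrow> herm z origin = snd z"
  by (simp add: herm_def origin_def points_closed)

lemma snd_point_nonzero:
  assumes "z \<in> points" "z \<noteq> origin" shows "snd z \<noteq> \<zero>"
  using herm_eq_zero[OF origin_point assms(1)] herm_origin[OF assms(1)] assms(2) by auto

text \<open>Swapping the outer coordinates of \<open>(c, b, 1)\<close> is an isometry that exchanges the origin with the point at infinity.
  This is that map, after rescaling \<open>(1, b, c)\<close> to last coordinate \<open>1\<close>.\<close>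
definition invert :: "'a \<times> 'a \<Rightarrow> 'a \<times> 'a" where
  "invert z = (fst z \<otimes> inv (snd z), inv (snd z))"

lemma herm_invert:
  assumes x: "x \<in> points" "x \<noteq> origin" and z: "z \<in> points" "z \<noteq> origin"
  shows "herm x z = snd x \<otimes> frob (snd z) \<otimes> herm (invert x) (invert z)"
proof -
  have u: "snd x \<in> Units R" "frob (snd z) \<in> Units R"
    using x z snd_point_nonzero by (auto simp: field_Units points_closed frob_eq_zero_iff)
  have cl: "fst z \<in> carrier R" "snd z \<in> carrier R" "fst x \<in> carrier R" "snd x \<in> carrier R"
    using x z by (auto simp: points_closed)
  define c d i j where "c = snd x" and "d = frob (snd z)" and "i = inv c" and "j = inv d"
  have ic: "c \<in> carrier R" "d \<in> carrier R" "i \<in> carrier R" "j \<in> carrier R"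
    using cl u by (auto simp: c_def d_def i_def j_def)
  have ci: "c \<otimes> i = \<one>" "d \<otimes> j = \<one>"
    using u by (auto simp: c_def d_def i_def j_def)
  have j': "frob (inv (snd z)) = j"
    using cl z snd_point_nonzero by (simp add: j_def d_def frob_inv)
  have "c \<otimes> d \<otimes> herm (invert x) (invert z)
      = c \<otimes> d \<otimes> (i \<oplus> fst x \<otimes> i \<otimes> (frob (fst z) \<otimes> j) \<oplus> j)"
  proof -
    have "inv (snd z) \<in> carrier R" using z cl snd_point_nonzero by (auto simp: field_Units)
    thus ?thesis using cl by (simp add: herm_def invert_def frob_mult j' i_def c_def)
  qed
  also have "\<dots> = (c \<otimes> i) \<otimes> d \<oplus> (c \<otimes> i) \<otimes> (d \<otimes> j) \<otimes> (fst x \<otimes> frob (fst z)) \<oplus> (d \<otimes> j) \<otimes> c"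
    using ic cl by (simp add: r_distr m_ac)
  also have "\<dots> = d \<oplus> fst x \<otimes> frob (fst z) \<oplus> c"
    unfolding ci using ic cl by simp
  also have "\<dots> = herm x z" using cl by (simp add: herm_def c_def d_def a_ac)
  finally show ?thesis by (simp add: c_def d_def)
qed

lemma invert_point:
  assumes z: "z \<in> points" "z \<noteq> origin"
  shows "invert z \<in> points" "invert z \<noteq> origin" "invert (invert z) = z"
proof -
  have cl: "fst z \<in> carrier R" "snd z \<in> carrier R" using z by (auto simp: points_closed)
  have nz: "snd z \<noteq> \<zero>" using snd_point_nonzero z by blast
  have u: "snd z \<in> Units R" using nz cl by (auto simp: field_Units)
  hence ui: "inv (snd z) \<in> Units R" "inv (snd z) \<in> carrier R" by auto
  have h: "herm (invert z) (invert z) \<in> carrier R"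
    using cl ui by (simp add: herm_def invert_def)
  have "snd z \<otimes> frob (snd z) \<otimes> herm (invert z) (invert z) = \<zero>"
    using herm_invert[OF z z] z by (simp add: points_iff)
  hence "herm (invert z) (invert z) = \<zero>"
    using h nz cl by (simp add: integral_iff frob_eq_zero_iff)
  thus "invert z \<in> points" using cl ui by (simp add: points_iff invert_def)
  show "invert z \<noteq> origin"
    using ui field_Units by (auto simp: invert_def origin_def)
  show "invert (invert z) = z"
    using cl u ui by (simp add: invert_def m_assoc prod_eq_iff)
qed

text \<open>The factor \<open>c\<^sub>x c\<^sub>z\<^sup>q\<close> by which the inversion rescales the form absorbs the factor \<open>qchar (snd z)\<close>, since
  norms are squares. What remains is the sum of \<open>sum_qchar_herm\<close> at the inverted point, without its
  term at the origin, which accounts for \<open>- 1\<close>.\<close>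
lemma sum_qchar_herm_herm_origin:
  assumes x: "x \<in> points" "x \<noteq> origin"
  shows "(\<Sum>z\<in>points. qchar (herm x z) * qchar (snd z)) =
    two_graph_sign * (int q ^ 2 - int q) * qchar (snd x) - 1"
proof -
  let ?A = "two_graph_sign * (int q ^ 2 - int q)"
  let ?P = "points - {origin}"
  have cl: "snd x \<in> carrier R" using x by (simp add: points_closed)
  have nz: "snd x \<noteq> \<zero>" using snd_point_nonzero x by blast
  note ix = invert_point[OF x]
  have "(\<Sum>z\<in>points. qchar (herm x z) * qchar (snd z)) = (\<Sum>z\<in>?P. qchar (herm x z) * qchar (snd z))"
    using finite_points origin_point by (subst sum.remove[of _ origin]) (auto simp: origin_def)
  also have "\<dots> = (\<Sum>z\<in>?P. qchar (snd x) * qchar (herm (invert x) (invert z)))"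
  proof (rule sum.cong)
    fix z assume z: "z \<in> ?P"
    hence cz: "snd z \<in> carrier R" "snd z \<noteq> \<zero>" by (auto simp: points_closed snd_point_nonzero)
    have h: "herm (invert x) (invert z) \<in> carrier R"
      using z ix invert_point by (intro herm_closed) auto
    have "qchar (herm x z) = qchar (snd x) * qchar (snd z) * qchar (herm (invert x) (invert z))"
      using z herm_invert[OF x, of z] cl cz h by (simp add: qchar_mult qchar_frob)
    thus "qchar (herm x z) * qchar (snd z) = qchar (snd x) * qchar (herm (invert x) (invert z))"
      using qchar_square[OF cz] by (simp add: algebra_simps)
  qed simp
  also have "\<dots> = (\<Sum>z\<in>?P. qchar (snd x) * qchar (herm (invert x) z))"
    by (rule sum.reindex_bij_witness[of _ invert invert]) (auto simp: invert_point)
  also have "\<dots> = qchar (snd x) * (\<Sum>z\<in>?P. qchar (herm (invert x) z))"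
    by (simp add: sum_distrib_left)
  also have "(\<Sum>z\<in>?P. qchar (herm (invert x) z)) =
      (\<Sum>z\<in>points. qchar (herm (invert x) z)) - qchar (herm (invert x) origin)"
    using finite_points origin_point by (simp add: sum_diff1)
  also have "(\<Sum>z\<in>points. qchar (herm (invert x) z)) = (\<Sum>z\<in>points. qchar (herm z (invert x)))"
    by (rule sum.cong) (use ix in \<open>auto simp: herm_swap[of _ "invert x"] qchar_frob herm_closed\<close>)
  also have "\<dots> = ?A" by (rule sum_qchar_herm[OF ix(1)])
  also have "qchar (herm (invert x) origin) = qchar (snd x)"
    using herm_origin[OF ix(1)] qchar_inv[OF cl nz] by (simp add: invert_def)
  finally show ?thesis using qchar_square[OF cl nz] by (simp add: algebra_simps)
qed

text \<open>A translation moves \<open>y\<close> to the origin.\<close>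
lemma sum_qchar_herm_herm:
  assumes x: "x \<in> points" and y: "y \<in> points" and ne: "x \<noteq> y"
  shows "(\<Sum>z\<in>points. qchar (herm x z) * qchar (herm z y)) =
    two_graph_sign * (int q ^ 2 - int q) * qchar (herm x y) - 1"
proof -
  have tx: "translate y x \<in> points" by (rule translate_points[OF y x])
  have "snd (translate y x) \<noteq> \<zero>"
    using herm_eq_zero[OF y x] ne by (auto simp: translate_def)
  hence t0: "translate y x \<noteq> origin" by (auto simp: origin_def)
  have "(\<Sum>z\<in>points. qchar (herm x z) * qchar (herm z y)) =
      (\<Sum>z\<in>points. qchar (herm (translate y x) (translate y z)) * qchar (snd (translate y z)))"
    by (rule sum.cong) (use x y herm_translate in \<open>auto simp: translate_def\<close>)
  also have "\<dots> = (\<Sum>z\<in>points. qchar (herm (translate y x) z) * qchar (snd z))"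
    by (rule sum.reindex_bij_betw[OF bij_translate[OF y]])
  also have "\<dots> = two_graph_sign * (int q ^ 2 - int q) * qchar (herm x y) - 1"
    using sum_qchar_herm_herm_origin[OF tx t0] by (simp add: translate_def)
  finally show ?thesis .
qed

text \<open>\<^const>\<open>None\<close> stands for the point at infinity.\<close>
definition unital :: "('a \<times> 'a) option set" where
  "unital = insert None (Some ` points)"

fun two_graph :: "('a \<times> 'a) option \<Rightarrow> ('a \<times> 'a) option \<Rightarrow> int" where
  "two_graph None None = 0"
| "two_graph None (Some z) = two_graph_sign"
| "two_graph (Some z) None = two_graph_sign"
| "two_graph (Some z) (Some w) = two_graph_sign * qchar (herm z w)"

lemma two_graph_sign_square: "two_graph_sign * two_graph_sign = 1" "two_graph_sign * (two_graph_sign * x) = x"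
  by (auto simp: two_graph_sign_def)

lemma sum_unital:
  fixes f :: "('a \<times> 'a) option \<Rightarrow> int"
  shows "(\<Sum>z\<in>unital. f z) = f None + (\<Sum>z\<in>points. f (Some z))"
  unfolding unital_def using finite_points by (subst sum.insert) (auto simp: sum.reindex)

lemma finite_unital: "finite unital"
  using finite_points by (simp add: unital_def)

lemma card_unital: "card unital = q ^ 3 + 1"
  using finite_points card_points by (simp add: unital_def card_image)

lemma two_graph_sym:
  assumes "x \<in> unital" "y \<in> unital" shows "two_graph x y = two_graph y x"
proof -
  have "qchar (herm z w) = qchar (herm w z)" if "z \<in> points" "w \<in> points" for z w
    using herm_swap[OF that] qchar_frob[OF herm_closed[OF that]] by simp
  thus ?thesis using assms by (cases x; cases y) (force simp: unital_def)+
qed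

lemma two_graph_diag: "x \<in> unital \<Longrightarrow> two_graph x x = 0"
  by (cases x) (auto simp: unital_def points_iff)

lemma two_graph_offdiag:
  assumes "x \<in> unital" "y \<in> unital" "x \<noteq> y"
  shows "two_graph x y = 1 \<or> two_graph x y = -1"
proof -
  have "two_graph_sign = 1 \<or> two_graph_sign = -1" by (simp add: two_graph_sign_def)
  moreover have "qchar (herm z w) = 1 \<or> qchar (herm z w) = -1"
    if "z \<in> points" "w \<in> points" "z \<noteq> w" for z w
    using herm_eq_zero[of w z] that by (auto simp: qchar_def)
  ultimately show ?thesis
    using assms by (cases x; cases y) (force simp: unital_def)+
qed

text \<open>For two distinct affine points the point at infinity contributes \<open>1\<close> to the sum, which cancels the \<open>- 1\<close> in
  \<open>sum_qchar_herm_herm\<close>. If one of the points is at infinity, the sum is the one in \<open>sum_qchar_herm\<close>.\<close>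
lemma two_graph_square:
  assumes x: "x \<in> unital" and y: "y \<in> unital"
  shows "(\<Sum>z\<in>unital. two_graph x z * two_graph z y) =
    (int q ^ 2 - int q) * two_graph x y + (if x = y then int q ^ 3 else 0)"
proof (cases "x = y")
  case True
  have "(\<Sum>z\<in>unital. two_graph x z * two_graph z y) = (\<Sum>z\<in>unital - {x}. two_graph x z * two_graph z x)"
    using finite_unital x True by (subst sum.remove[of _ x]) (auto simp: two_graph_diag)
  also have "\<dots> = (\<Sum>z\<in>unital - {x}. 1)"
    using x two_graph_offdiag two_graph_sym by (intro sum.cong) (auto, force)
  also have "\<dots> = int q ^ 3"
    using x finite_unital card_unital by simp
  finally show ?thesis using True x by (simp add: two_graph_diag)
next
  case False
  show ?thesis
  proof (cases x)
    case None
    then obtain w where w: "y = Some w" "w \<in> points" using y False by (auto simp: unital_def)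
    show ?thesis
      using sum_qchar_herm[OF w(2)]
      by (simp add: sum_unital None w(1) two_graph_sign_square mult.assoc sum_distrib_left[symmetric])
  next
    case (Some u)
    hence u: "u \<in> points" using x by (auto simp: unital_def)
    show ?thesis
    proof (cases y)
      case None
      have "(\<Sum>z\<in>points. qchar (herm u z)) = (\<Sum>z\<in>points. qchar (herm z u))"
        by (rule sum.cong) (use u in \<open>auto simp: herm_swap[of _ u] qchar_frob herm_closed\<close>)
      thus ?thesis
        using sum_qchar_herm[OF u]
        by (simp add: sum_unital None Some two_graph_sign_square mult.commute mult.left_commute
            sum_distrib_left[symmetric])
    next
      case (Some w)
      hence w: "w \<in> points" using y by (auto simp: unital_def)
      have e: "two_graph x (Some z) * two_graph (Some z) y = qchar (herm u z) * qchar (herm z w)" for z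
        using \<open>x = Some u\<close> Some by (simp add: two_graph_sign_square mult.commute mult.left_commute)
      have n: "two_graph x None * two_graph None y = 1"
        using \<open>x = Some u\<close> Some by (simp add: two_graph_sign_square)
      show ?thesis
        unfolding sum_unital e n
        using sum_qchar_herm_herm[OF u w] False \<open>x = Some u\<close> Some by (simp add: mult_ac)
    qed
  qed
qed

end

text \<open>The points are numbered by the naturals below \<open>n\<close>, as graphs have such vertex sets.\<close>
locale unitary_seidel_matrix =
  fixes q n :: nat and S :: "nat \<Rightarrow> nat \<Rightarrow> int"
  assumes q: "q > 1" and n: "n = q ^ 3 + 1"
    and S_sym: "\<And>x y. x < n \<Longrightarrow> y < n \<Longrightarrow> S x y = S y x"
    and S_diag: "\<And>x. x < n \<Longrightarrow> S x x = 0"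
    and S_off: "\<And>x y. x < n \<Longrightarrow> y < n \<Longrightarrow> x \<noteq> y \<Longrightarrow> S x y = 1 \<or> S x y = -1"
    and S_square: "\<And>x y. x < n \<Longrightarrow> y < n \<Longrightarrow>
      (\<Sum>z<n. S x z * S z y) = (int q ^ 2 - int q) * S x y + (if x = y then int q ^ 3 else 0)"

theorem unitary_seidel_matrix_exists:
  fixes q :: nat
  assumes pp: "primepow q" and odd: "odd q"
  shows "\<exists>S. unitary_seidel_matrix q (q ^ 3 + 1) S"
proof -
  obtain p m where p: "prime p" and m: "m > 0" and q: "q = p ^ m"
    using pp by (auto simp: primepow_def)
  obtain R :: "((int list \<times> nat) multiset \<Rightarrow> int) ring"
    where R: "field R" "finite (carrier R)" "card (carrier R) = p ^ (2 * m)"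
      "[p] \<cdot>\<^bsub>R\<^esub> \<one>\<^bsub>R\<^esub> = \<zero>\<^bsub>R\<^esub>"
    using finite_field_exists[OF p, of "2 * m"] m by auto
  interpret field R by (rule R(1))
  interpret odd_square_field R q
  proof
    show "card (carrier R) = q\<^sup>2" using R(3) by (simp add: q power_mult[symmetric] mult.commute)
    show "q > 1" using primepow_gt_Suc_0[OF pp] by simp
    show "(x \<oplus>\<^bsub>R\<^esub> y) [^]\<^bsub>R\<^esub> q = x [^]\<^bsub>R\<^esub> q \<oplus>\<^bsub>R\<^esub> y [^]\<^bsub>R\<^esub> q"
      if "x \<in> carrier R" "y \<in> carrier R" for x y
      unfolding q by (rule frobenius_add[OF p R(4) that])
  qed (use R(2) odd in auto)
  obtain f where f: "bij_betw f {..<q ^ 3 + 1} unital"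
    using ex_bij_betw_nat_finite[OF finite_unital] by (auto simp: card_unital atLeast0LessThan)
  have fu: "f x \<in> unital" if "x < q ^ 3 + 1" for x
    using f that by (auto simp: bij_betw_def)
  have fi: "f x = f y \<longleftrightarrow> x = y" if "x < q ^ 3 + 1" "y < q ^ 3 + 1" for x y
    using f that by (auto simp: bij_betw_def inj_on_eq_iff)
  have "unitary_seidel_matrix q (q ^ 3 + 1) (\<lambda>x y. two_graph (f x) (f y))"
  proof
    show "q > 1" using primepow_gt_Suc_0[OF pp] by simp
    show "two_graph (f x) (f x) = 0" if "x < q ^ 3 + 1" for x
      using fu[OF that] by (rule two_graph_diag)
    fix x y assume xy: "x < q ^ 3 + 1" "y < q ^ 3 + 1"
    show "two_graph (f x) (f y) = two_graph (f y) (f x)" using xy fu two_graph_sym by blast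
    show "x \<noteq> y \<Longrightarrow> two_graph (f x) (f y) = 1 \<or> two_graph (f x) (f y) = -1"
      using xy fu fi two_graph_offdiag by blast
    have "(\<Sum>z<q ^ 3 + 1. two_graph (f x) (f z) * two_graph (f z) (f y)) =
        (\<Sum>z\<in>unital. two_graph (f x) z * two_graph z (f y))"
      by (rule sum.reindex_bij_betw[OF f])
    thus "(\<Sum>z<q ^ 3 + 1. two_graph (f x) (f z) * two_graph (f z) (f y)) =
        (int q ^ 2 - int q) * two_graph (f x) (f y) + (if x = y then int q ^ 3 else 0)"
      using two_graph_square[OF fu[OF xy(1)] fu[OF xy(2)]] fi[OF xy] by simp
  qed simp
  thus ?thesis by blast
qed

section \<open>The spectral theorem for real symmetric matrices\<close>
lemma quadratic_symmetric:
  fixes A :: "real mat"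
  assumes A: "A \<in> carrier_mat n n" and sym: "transpose_mat A = A"
    and x: "x \<in> carrier_vec n" and y: "y \<in> carrier_vec n"
  shows "x \<bullet> (A *\<^sub>v y) = y \<bullet> (A *\<^sub>v x)"
proof -
  have "x \<bullet> (A *\<^sub>v y) = (transpose_mat A *\<^sub>v x) \<bullet> y"
    using transpose_vec_mult_scalar[OF A y x] by simp
  also have "\<dots> = y \<bullet> (A *\<^sub>v x)"
    unfolding sym by (rule comm_scalar_prod) (use A x y in auto)
  finally show ?thesis .
qed

lemma scalar_prod_self_pos:
  fixes x :: "real vec"
  assumes x: "x \<in> carrier_vec n" and "x \<noteq> 0\<^sub>v n"
  shows "x \<bullet> x > 0"
proof -
  obtain i where i: "i < n" "x $ i \<noteq> 0"
    using assms by (metis carrier_vecD eq_vecI index_zero_vec(1,2))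
  have sq: "0 < a * a" if "a \<noteq> 0" for a :: real
    using that by (metis not_real_square_gt_zero)
  have "0 < (\<Sum>j\<in>{0..<n}. x $ j * x $ j)"
    by (rule sum_pos2[of _ i]) (use i sq in auto)
  thus ?thesis using x by (simp add: scalar_prod_def)
qed

text \<open>For a complex eigenvector \<open>x + i y\<close> with eigenvalue \<open>z\<close>, evaluating the symmetric form at \<open>(x, y)\<close> in both orders
  gives \<open>Im z (x \<bullet> x + y \<bullet> y) = 0\<close>. So \<open>z\<close> is real, and whichever of \<open>x\<close> and \<open>y\<close> is nonzero is a real eigenvector.\<close>
lemma real_symmetric_unit_eigenvector:
  fixes A :: "real mat"
  assumes A: "A \<in> carrier_mat n n" and sym: "transpose_mat A = A" and n: "n > 0"
  obtains e v where "v \<in> carrier_vec n" "v \<bullet> v = 1" "A *\<^sub>v v = e \<cdot>\<^sub>v v"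
proof -
  let ?A = "map_mat complex_of_real A"
  have cA: "?A \<in> carrier_mat n n" using A by simp
  obtain z where "z \<in> spectrum ?A"
    using spectrum_non_empty[OF cA n] by auto
  then obtain u where u: "u \<in> carrier_vec n" "u \<noteq> 0\<^sub>v n" "?A *\<^sub>v u = z \<cdot>\<^sub>v u"
    using cA by (auto simp: spectrum_def eigenvalue_def eigenvector_def)
  define x where "x = map_vec Re u"
  define y where "y = map_vec Im u"
  have xy: "x \<in> carrier_vec n" "y \<in> carrier_vec n" using u by (auto simp: x_def y_def)
  have Ax: "A *\<^sub>v x = Re z \<cdot>\<^sub>v x - Im z \<cdot>\<^sub>v y" and Ay: "A *\<^sub>v y = Im z \<cdot>\<^sub>v x + Re z \<cdot>\<^sub>v y"
  proof -
    have c: "(\<Sum>j\<in>{0..<n}. complex_of_real (A $$ (i, j)) * u $ j) = z * u $ i" if i: "i < n" for i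
    proof -
      have "(\<Sum>j\<in>{0..<n}. complex_of_real (A $$ (i, j)) * u $ j) = (?A *\<^sub>v u) $ i"
        using i A u(1) by (simp add: scalar_prod_def row_def)
      thus ?thesis unfolding u(3) using i u(1) by simp
    qed
    show "A *\<^sub>v x = Re z \<cdot>\<^sub>v x - Im z \<cdot>\<^sub>v y"
    proof (rule eq_vecI)
      fix i assume "i < dim_vec (Re z \<cdot>\<^sub>v x - Im z \<cdot>\<^sub>v y)"
      hence i: "i < n" using xy by simp
      show "(A *\<^sub>v x) $ i = (Re z \<cdot>\<^sub>v x - Im z \<cdot>\<^sub>v y) $ i"
        using arg_cong[OF c[OF i], of Re] i A u by (simp add: scalar_prod_def row_def x_def y_def)
    qed (use A xy in auto)
    show "A *\<^sub>v y = Im z \<cdot>\<^sub>v x + Re z \<cdot>\<^sub>v y"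
    proof (rule eq_vecI)
      fix i assume "i < dim_vec (Im z \<cdot>\<^sub>v x + Re z \<cdot>\<^sub>v y)"
      hence i: "i < n" using xy by simp
      show "(A *\<^sub>v y) $ i = (Im z \<cdot>\<^sub>v x + Re z \<cdot>\<^sub>v y) $ i"
        using arg_cong[OF c[OF i], of Im] i A u by (simp add: scalar_prod_def row_def x_def y_def)
    qed (use A xy in auto)
  qed
  have "x \<noteq> 0\<^sub>v n \<or> y \<noteq> 0\<^sub>v n"
  proof (rule ccontr)
    assume "\<not> ?thesis"
    hence "x = 0\<^sub>v n" "y = 0\<^sub>v n" by auto
    have "u = 0\<^sub>v n"
    proof (rule eq_vecI)
      fix i assume "i < dim_vec (0\<^sub>v n :: complex vec)"
      hence i: "i < n" by simp
      have "x $ i = 0" "y $ i = 0" using \<open>x = 0\<^sub>v n\<close> \<open>y = 0\<^sub>v n\<close> i by auto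
      thus "u $ i = 0\<^sub>v n $ i" using i u by (simp add: x_def y_def complex_eq_iff)
    qed (use u in auto)
    thus False using u by simp
  qed
  hence pos: "x \<bullet> x + y \<bullet> y > 0"
    using scalar_prod_self_pos[OF xy(1)] scalar_prod_self_pos[OF xy(2)]
    by (metis add_pos_pos add.right_neutral add.left_neutral scalar_prod_right_zero xy)
  have "x \<bullet> (A *\<^sub>v y) = y \<bullet> (A *\<^sub>v x)" by (rule quadratic_symmetric[OF A sym xy])
  hence "Im z * (x \<bullet> x + y \<bullet> y) = 0"
    unfolding Ax Ay using xy comm_scalar_prod[OF xy]
    by (simp add: scalar_prod_add_distrib[of _ n] scalar_prod_minus_distrib[of _ n] algebra_simps)
  hence z: "Im z = 0" using pos by auto
  have ev: "A *\<^sub>v x = Re z \<cdot>\<^sub>v x" "A *\<^sub>v y = Re z \<cdot>\<^sub>v y"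
    unfolding Ax Ay z using xy by auto
  obtain w where w: "w \<in> carrier_vec n" "w \<noteq> 0\<^sub>v n" "A *\<^sub>v w = Re z \<cdot>\<^sub>v w"
    using \<open>x \<noteq> 0\<^sub>v n \<or> y \<noteq> 0\<^sub>v n\<close> ev xy by blast
  define a where "a = 1 / sqrt (w \<bullet> w)"
  have p: "w \<bullet> w > 0" by (rule scalar_prod_self_pos[OF w(1,2)])
  show ?thesis
  proof (rule that[of "a \<cdot>\<^sub>v w" "Re z"])
    have "(a \<cdot>\<^sub>v w) \<bullet> (a \<cdot>\<^sub>v w) = a * a * (w \<bullet> w)" using w by simp
    also have "\<dots> = 1" using p by (simp add: a_def)
    finally show "(a \<cdot>\<^sub>v w) \<bullet> (a \<cdot>\<^sub>v w) = 1" .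
    show "A *\<^sub>v (a \<cdot>\<^sub>v w) = Re z \<cdot>\<^sub>v (a \<cdot>\<^sub>v w)"
      using A w by (simp add: mult_mat_vec smult_smult_assoc mult.commute)
  qed (use w in auto)
qed

text \<open>The reflection in the hyperplane orthogonal to \<open>v - e\<^sub>0\<close> exchanges the unit vectors \<open>e\<^sub>0\<close> and \<open>v\<close>.\<close>
lemma householder_reflection:
  fixes v :: "real vec"
  assumes v: "v \<in> carrier_vec n" and unit: "v \<bullet> v = 1" and n: "n > 0"
  obtains H where "H \<in> carrier_mat n n" "transpose_mat H = H" "H * H = 1\<^sub>m n"
    "H *\<^sub>v unit_vec n 0 = v"
proof (cases "v = unit_vec n 0")
  case True
  show ?thesis by (rule that[of "1\<^sub>m n"]) (use True in auto)
next
  case False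
  define w where "w = v - unit_vec n 0"
  have w: "w \<in> carrier_vec n" using v by (simp add: w_def)
  have "w \<noteq> 0\<^sub>v n"
  proof
    assume "w = 0\<^sub>v n"
    hence "v $ i - unit_vec n 0 $ i = 0" if "i < n" for i
      using that v unfolding w_def by (metis carrier_vecD index_minus_vec(1) index_unit_vec(3) index_zero_vec(1))
    hence "v = unit_vec n 0" using v by (intro eq_vecI) auto
    thus False using False by simp
  qed
  hence pos: "w \<bullet> w > 0" using scalar_prod_self_pos[OF w] by simp
  define c where "c = 2 / (w \<bullet> w)"
  have cw: "c * (w \<bullet> w) = 2" using pos by (simp add: c_def)
  have wi: "w $ i = v $ i - (if i = 0 then 1 else 0)" if "i < n" for i
    using that v n by (simp add: w_def)
  have "w \<bullet> w = (\<Sum>i\<in>{0..<n}. v $ i * v $ i) + (\<Sum>i\<in>{0..<n}. if i = 0 then 1 - 2 * v $ 0 else 0)"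
    unfolding scalar_prod_def sum.distrib[symmetric]
    using w v by (intro sum.cong) (auto simp: wi algebra_simps)
  also have "\<dots> = 1 + (1 - 2 * v $ 0)"
    using unit v n by (simp add: scalar_prod_def)
  also have "\<dots> = - 2 * w $ 0" using n by (simp add: wi)
  finally have w0: "w \<bullet> w = - 2 * w $ 0" .
  define H where "H = mat n n (\<lambda>(i, j). (if i = j then 1 else 0) - c * w $ i * w $ j)"
  have H: "H \<in> carrier_mat n n" by (simp add: H_def)
  show ?thesis
  proof (rule that[OF H])
    show "transpose_mat H = H" by (rule eq_matI) (auto simp: H_def)
    show "H * H = 1\<^sub>m n"
    proof (rule eq_matI)
      fix i j assume "i < dim_row (1\<^sub>m n :: real mat)" "j < dim_col (1\<^sub>m n :: real mat)"
      hence ij: "i < n" "j < n" by auto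
      have "(H * H) $$ (i, j) = (\<Sum>k\<in>{0..<n}. H $$ (i, k) * H $$ (k, j))"
        using ij H by (simp add: scalar_prod_def)
      also have "\<dots> = (\<Sum>k\<in>{0..<n}. (if k = i then (if i = j then 1 else 0) else 0)
          - (if k = i then c * w $ i * w $ j else 0) - (if k = j then c * w $ i * w $ j else 0)
          + c * w $ i * w $ j * c * (w $ k * w $ k))"
        using ij by (intro sum.cong) (auto simp: H_def algebra_simps)
      also have "\<dots> = (if i = j then 1 else 0) - 2 * (c * w $ i * w $ j)
          + c * w $ i * w $ j * (c * (w \<bullet> w))"
        using ij w by (simp add: sum.distrib sum_subtractf sum_distrib_left[symmetric]
            scalar_prod_def mult.assoc)
      also have "\<dots> = 1\<^sub>m n $$ (i, j)" unfolding cw using ij by simp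
      finally show "(H * H) $$ (i, j) = 1\<^sub>m n $$ (i, j)" .
    qed (use H in auto)
    show "H *\<^sub>v unit_vec n 0 = v"
    proof (rule eq_vecI)
      fix i assume "i < dim_vec v"
      hence i: "i < n" using v by simp
      have "(H *\<^sub>v unit_vec n 0) $ i = H $$ (i, 0)" using i n H by simp
      also have "\<dots> = (if i = 0 then 1 else 0) - c * w $ 0 * w $ i"
        using i n by (simp add: H_def)
      also have "c * w $ 0 = -1" using cw w0 by simp
      finally show "(H *\<^sub>v unit_vec n 0) $ i = v $ i" using i by (simp add: wi)
    qed (use H v in auto)
  qed
qed

definition orth_diag :: "nat \<Rightarrow> real mat \<Rightarrow> real mat \<Rightarrow> (nat \<Rightarrow> real) \<Rightarrow> bool" where
  "orth_diag n A U e \<longleftrightarrow> U \<in> carrier_mat n n \<and> transpose_mat U * U = 1\<^sub>m n \<and>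
     A = U * mat_diag n e * transpose_mat U"

text \<open>Conjugation by a reflection that exchanges a unit eigenvector with \<open>e\<^sub>0\<close> turns the first column, and by symmetry
  the first row, into a multiple of \<open>e\<^sub>0\<close>. The remaining block is symmetric of smaller size.\<close>
theorem spectral_theorem_real_symmetric:
  fixes A :: "real mat"
  assumes "A \<in> carrier_mat n n" and "transpose_mat A = A"
  shows "\<exists>U e. orth_diag n A U e"
  using assms
proof (induction n arbitrary: A)
  case 0
  show ?case
    by (intro exI[of _ "1\<^sub>m 0"] exI[of _ "\<lambda>_. 0"]) (use 0 in \<open>auto simp: orth_diag_def\<close>)
next
  case (Suc n)
  let ?N = "Suc n"
  note A = Suc.prems(1) and sym = Suc.prems(2)
  obtain ev v where v: "v \<in> carrier_vec ?N" "v \<bullet> v = 1" "A *\<^sub>v v = ev \<cdot>\<^sub>v v"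
    using real_symmetric_unit_eigenvector[OF A sym] by blast
  obtain H where H: "H \<in> carrier_mat ?N ?N" "transpose_mat H = H" "H * H = 1\<^sub>m ?N"
    "H *\<^sub>v unit_vec ?N 0 = v"
    using householder_reflection[OF v(1,2)] by blast
  define B where "B = H * A * H"
  have B: "B \<in> carrier_mat ?N ?N" using A H by (simp add: B_def)
  have symB: "transpose_mat B = B"
  proof -
    have "transpose_mat B = H * (A * H)"
      unfolding B_def using A H sym by (simp add: transpose_mult[of _ ?N ?N _ ?N])
    thus ?thesis using A H by (simp add: B_def assoc_mult_mat[of _ ?N ?N _ ?N _ ?N])
  qed
  have "B *\<^sub>v unit_vec ?N 0 = H *\<^sub>v (A *\<^sub>v (H *\<^sub>v unit_vec ?N 0))"
    unfolding B_def using A H by (simp add: assoc_mult_mat_vec[of _ ?N ?N _ ?N])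
  also have "\<dots> = ev \<cdot>\<^sub>v (H *\<^sub>v v)" using v H by (simp add: mult_mat_vec)
  also have "H *\<^sub>v v = (H * H) *\<^sub>v unit_vec ?N 0"
    unfolding H(4)[symmetric] using H(1) by (simp add: assoc_mult_mat_vec[of _ ?N ?N _ ?N])
  also have "\<dots> = unit_vec ?N 0" unfolding H(3) by simp
  finally have col0: "B *\<^sub>v unit_vec ?N 0 = ev \<cdot>\<^sub>v unit_vec ?N 0" .
  have Bi0: "B $$ (i, 0) = (if i = 0 then ev else 0)" if i: "i < ?N" for i
  proof -
    have "B $$ (i, 0) = (B *\<^sub>v unit_vec ?N 0) $ i" using i B by simp
    thus ?thesis unfolding col0 using i by simp
  qed
  have B0i: "B $$ (0, i) = (if i = 0 then ev else 0)" if i: "i < ?N" for i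
    using Bi0[OF i] B i symB by (metis carrier_matD index_transpose_mat(1) zero_less_Suc)
  define C where "C = mat n n (\<lambda>(i, j). B $$ (Suc i, Suc j))"
  have C: "C \<in> carrier_mat n n" by (simp add: C_def)
  have symC: "transpose_mat C = C"
  proof (rule eq_matI)
    fix i j assume "i < dim_row C" "j < dim_col C"
    hence ij: "i < n" "j < n" by (auto simp: C_def)
    have "B $$ (Suc j, Suc i) = B $$ (Suc i, Suc j)"
      using symB B ij by (metis Suc_less_eq carrier_matD index_transpose_mat(1))
    thus "transpose_mat C $$ (i, j) = C $$ (i, j)" using ij by (simp add: C_def)
  qed (auto simp: C_def)
  obtain V f where V: "V \<in> carrier_mat n n" "transpose_mat V * V = 1\<^sub>m n"
    and CV: "C = V * mat_diag n f * transpose_mat V"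
    using Suc.IH[OF C symC] by (auto simp: orth_diag_def)
  let ?z = "0\<^sub>m 1 n" let ?z' = "0\<^sub>m n 1"
  let ?blk = "\<lambda>a M. four_block_mat (mat 1 1 (\<lambda>_. a)) ?z ?z' M"
  have Bblk: "B = ?blk ev C"
  proof (rule eq_matI)
    fix i j assume "i < dim_row (?blk ev C)" "j < dim_col (?blk ev C)"
    hence ij: "i < ?N" "j < ?N" using C by auto
    show "B $$ (i, j) = ?blk ev C $$ (i, j)"
      using ij B0i Bi0 C by (cases i; cases j) (auto simp: C_def)
  qed (use B C in auto)
  define e where "e = (\<lambda>i. case i of 0 \<Rightarrow> ev | Suc j \<Rightarrow> f j)"
  have D: "mat_diag ?N e = ?blk ev (mat_diag n f)"
  proof (rule eq_matI)
    fix i j assume "i < dim_row (?blk ev (mat_diag n f))" "j < dim_col (?blk ev (mat_diag n f))"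
    hence ij: "i < ?N" "j < ?N" by (auto simp: mat_diag_def)
    show "mat_diag ?N e $$ (i, j) = ?blk ev (mat_diag n f) $$ (i, j)"
      using ij by (cases i; cases j) (auto simp: mat_diag_def e_def)
  qed (auto simp: mat_diag_def)
  have blk_mult: "?blk a M * ?blk b M' = ?blk (a * b) (M * M')"
    if M: "M \<in> carrier_mat n n" "M' \<in> carrier_mat n n" for a b :: real and M M'
  proof -
    have "?blk a M * ?blk b M' = four_block_mat (mat 1 1 (\<lambda>_. a) * mat 1 1 (\<lambda>_. b) + ?z * ?z')
       (mat 1 1 (\<lambda>_. a) * ?z + ?z * M') (?z' * mat 1 1 (\<lambda>_. b) + M * ?z') (?z' * ?z + M * M')"
      by (rule mult_four_block_mat) (use M in auto)
    also have "mat 1 1 (\<lambda>_. a) * mat 1 1 (\<lambda>_. b) + ?z * ?z' = mat 1 1 (\<lambda>_. a * b)"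
      by (rule eq_matI) (auto simp: scalar_prod_def)
    also have "mat 1 1 (\<lambda>_. a) * ?z + ?z * M' = ?z"
      using M by (intro eq_matI) (auto simp: scalar_prod_def)
    also have "?z' * mat 1 1 (\<lambda>_. b) + M * ?z' = ?z'"
      using M by (intro eq_matI) (auto simp: scalar_prod_def)
    also have "?z' * ?z + M * M' = M * M'"
      using M by (intro eq_matI) (auto simp: scalar_prod_def)
    finally show ?thesis .
  qed
  have blk_one: "?blk 1 (1\<^sub>m n) = 1\<^sub>m ?N"
    by (rule eq_matI) auto
  have blk_tr: "transpose_mat (?blk a M) = ?blk a (transpose_mat M)" if "M \<in> carrier_mat n n"
    for a :: real and M
    using that by (intro eq_matI) auto
  define W where "W = ?blk 1 V"
  have W: "W \<in> carrier_mat ?N ?N" using V by (intro carrier_matI) (auto simp: W_def)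
  have VT: "transpose_mat V \<in> carrier_mat n n" using V by simp
  have VD: "V * mat_diag n f \<in> carrier_mat n n" by (rule mult_carrier_mat[OF V(1) mat_diag_dim])
  have WW: "transpose_mat W * W = 1\<^sub>m ?N"
    unfolding W_def by (simp only: blk_tr[OF V(1)] blk_mult[OF VT V(1)] V(2) blk_one mult_1_left)
  have BW: "B = W * mat_diag ?N e * transpose_mat W"
    unfolding W_def D Bblk CV
    by (simp only: blk_tr[OF V(1)] blk_mult[OF V(1) mat_diag_dim] blk_mult[OF VD VT]
        mult_1_left mult_1_right)
  have "orth_diag ?N A (H * W) e"
    unfolding orth_diag_def
  proof (intro conjI)
    show "H * W \<in> carrier_mat ?N ?N" using H W by simp
    have tr: "transpose_mat (H * W) = transpose_mat W * H"
      using H W by (simp add: transpose_mult[of _ ?N ?N _ ?N])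
    have "transpose_mat (H * W) * (H * W) = transpose_mat W * (H * (H * W))"
      unfolding tr using H W by (simp add: assoc_mult_mat[of _ ?N ?N _ ?N _ ?N])
    also have "H * (H * W) = (H * H) * W"
      using H(1) W by (simp add: assoc_mult_mat[of _ ?N ?N _ ?N _ ?N])
    finally show "transpose_mat (H * W) * (H * W) = 1\<^sub>m ?N"
      using H W WW by simp
    have "H * B * H = (H * H) * A * (H * H)"
      unfolding B_def using A H(1) by (simp add: assoc_mult_mat[of _ ?N ?N _ ?N _ ?N])
    also have "\<dots> = A" unfolding H(3) using A by simp
    finally have "A = H * B * H" by simp
    also have "\<dots> = H * W * mat_diag ?N e * transpose_mat (H * W)"
    proof -
      have c: "mat_diag ?N e \<in> carrier_mat ?N ?N" "mat_diag ?N e * transpose_mat W \<in> carrier_mat ?N ?N"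
        "W * (mat_diag ?N e * transpose_mat W) \<in> carrier_mat ?N ?N"
        using W mat_diag_dim[of ?N e] by (auto intro!: mult_carrier_mat)
      show ?thesis
        unfolding BW tr using H(1) W c by (simp add: assoc_mult_mat[of _ ?N ?N _ ?N _ ?N])
    qed
    finally show "A = H * W * mat_diag ?N e * transpose_mat (H * W)" .
  qed
  thus ?case by blast
qed


lemma orth_diag_inverse:
  assumes "orth_diag n A U e" shows "U * transpose_mat U = 1\<^sub>m n"
  using assms mat_mult_left_right_inverse[of "transpose_mat U" n U]
  by (auto simp: orth_diag_def)

lemma orth_diag_carrier: "orth_diag n A U e \<Longrightarrow> A \<in> carrier_mat n n"
  by (auto simp: orth_diag_def intro!: mult_carrier_mat)

lemma orth_diag_norm:
  assumes d: "orth_diag n A U e" and x: "x \<in> carrier_vec n"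
  defines "z \<equiv> transpose_mat U *\<^sub>v x"
  shows "x \<bullet> x = (\<Sum>i\<in>{0..<n}. (z $ i)\<^sup>2)"
proof -
  have U: "U \<in> carrier_mat n n" using d by (simp add: orth_diag_def)
  have z: "z \<in> carrier_vec n" using U x by (simp add: z_def)
  have "x = U *\<^sub>v z"
    unfolding z_def using U x orth_diag_inverse[OF d]
    by (simp add: assoc_mult_mat_vec[of U n n "transpose_mat U" n x, symmetric])
  hence "x \<bullet> x = x \<bullet> (U *\<^sub>v z)" by simp
  also have "\<dots> = z \<bullet> z"
    using transpose_vec_mult_scalar[OF U z x] by (simp add: z_def)
  finally show ?thesis using z by (simp add: scalar_prod_def power2_eq_square)
qed

lemma orth_diag_quadratic:
  assumes d: "orth_diag n A U e" and x: "x \<in> carrier_vec n"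
  defines "z \<equiv> transpose_mat U *\<^sub>v x"
  shows "x \<bullet> (A *\<^sub>v x) = (\<Sum>i\<in>{0..<n}. e i * (z $ i)\<^sup>2)"
proof -
  have U: "U \<in> carrier_mat n n" and A: "A = U * mat_diag n e * transpose_mat U"
    using d by (auto simp: orth_diag_def)
  have z: "z \<in> carrier_vec n" using U x by (simp add: z_def)
  have D: "mat_diag n e *\<^sub>v z \<in> carrier_vec n" using z mat_diag_dim by (rule mult_mat_vec_carrier[rotated])
  have "A *\<^sub>v x = U *\<^sub>v (mat_diag n e *\<^sub>v z)"
    unfolding A z_def using U x mat_diag_dim[of n e]
    by (simp add: assoc_mult_mat_vec[of _ n n _ n])
  hence "x \<bullet> (A *\<^sub>v x) = z \<bullet> (mat_diag n e *\<^sub>v z)"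
    using transpose_vec_mult_scalar[OF U D x] by (simp add: z_def)
  have dimD: "dim_row (mat_diag n e) = n" "dim_col (mat_diag n e) = n"
    by (simp_all add: mat_diag_def)
  note \<open>x \<bullet> (A *\<^sub>v x) = z \<bullet> (mat_diag n e *\<^sub>v z)\<close>
  also have "mat_diag n e *\<^sub>v z = vec n (\<lambda>i. e i * z $ i)"
  proof (rule eq_vecI)
    fix i assume "i < dim_vec (vec n (\<lambda>i. e i * z $ i))"
    hence i: "i < n" by simp
    have "(mat_diag n e *\<^sub>v z) $ i = (\<Sum>j\<in>{0..<n}. mat_diag n e $$ (i, j) * z $ j)"
      using i z by (simp add: scalar_prod_def dimD)
    also have "\<dots> = (\<Sum>j\<in>{0..<n}. if j = i then e i * z $ i else 0)"
      using i by (intro sum.cong) (auto simp: mat_diag_def)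
    finally show "(mat_diag n e *\<^sub>v z) $ i = vec n (\<lambda>i. e i * z $ i) $ i" using i by simp
  qed (simp add: mat_diag_def)
  finally show ?thesis
    using z by (simp add: scalar_prod_def power2_eq_square algebra_simps)
qed

lemma orth_diag_uminus:
  assumes d: "orth_diag n A U e" shows "orth_diag n (- A) U (\<lambda>i. - e i)"
proof -
  have U: "U \<in> carrier_mat n n" and A: "A = U * mat_diag n e * transpose_mat U"
    using d by (auto simp: orth_diag_def)
  have neg: "- M = (-1) \<cdot>\<^sub>m M" for M :: "real mat"
    by (rule eq_matI) auto
  have "- A = U * ((-1) \<cdot>\<^sub>m mat_diag n e) * transpose_mat U"
    unfolding A neg using U
    by (simp add: mult_smult_distrib[OF U mat_diag_dim]
        mult_smult_assoc_mat[OF mult_carrier_mat[OF U mat_diag_dim], of _ n])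
  also have "(-1) \<cdot>\<^sub>m mat_diag n e = mat_diag n (\<lambda>i. - e i)"
    by (rule eq_matI) (auto simp: mat_diag_def)
  finally show ?thesis using d by (simp add: orth_diag_def)
qed

lemma proots_orth_diag:
  assumes d: "orth_diag n A U e"
  shows "proots (char_poly A) = mset (map e [0..<n])"
proof -
  have U: "U \<in> carrier_mat n n" and A: "A = U * mat_diag n e * transpose_mat U"
    and UU: "transpose_mat U * U = 1\<^sub>m n"
    using d by (auto simp: orth_diag_def)
  have "similar_mat_wit A (mat_diag n e) U (transpose_mat U)"
    by (rule similar_mat_witI[OF orth_diag_inverse[OF d] UU A orth_diag_carrier[OF d]])
       (use U in auto)
  hence "char_poly A = char_poly (mat_diag n e)"
    by (intro char_poly_similar) (auto simp: similar_mat_def)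
  also have "\<dots> = (\<Prod>a\<leftarrow>diag_mat (mat_diag n e). [:- a, 1:])"
    by (rule char_poly_upper_triangular[OF mat_diag_dim]) (auto simp: mat_diag_def)
  also have "diag_mat (mat_diag n e) = map e [0..<n]"
    by (auto simp: diag_mat_def mat_diag_def)
  finally have "char_poly A = (\<Prod>a\<leftarrow>map e [0..<n]. [:- a, 1:])" .
  moreover have "proots (\<Prod>a\<leftarrow>xs. [:- a, 1:]) = mset xs" for xs :: "real list"
  proof (induction xs)
    case (Cons a xs)
    have "(\<Prod>a\<leftarrow>xs. [:- a, 1:]) \<noteq> 0" by (auto simp: prod_list_zero_iff)
    hence "proots (\<Prod>a\<leftarrow>a # xs. [:- a, 1:]) = proots [:- a, 1:] + proots (\<Prod>a\<leftarrow>xs. [:- a, 1:])"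
      by (simp only: list.map prod_list.Cons, intro proots_mult no_zero_divisors) auto
    thus ?case unfolding Cons.IH by simp
  qed simp
  ultimately show ?thesis by metis
qed

section \<open>Counting eigenvalues by test spaces\<close>

text \<open>Padding the coefficient matrix with zero rows makes it square and singular.\<close>
lemma homogeneous_system_nontrivial:
  fixes B :: "real mat"
  assumes B: "B \<in> carrier_mat s k" and less: "s < k"
  obtains y where "y \<in> carrier_vec k" "y \<noteq> 0\<^sub>v k" "B *\<^sub>v y = 0\<^sub>v s"
proof -
  define A where "A = mat k k (\<lambda>(i, j). if i < s then B $$ (i, j) else 0)"
  have A: "A \<in> carrier_mat k k" by (simp add: A_def)
  have "transpose_mat A *\<^sub>v unit_vec k s = 0\<^sub>v k"
  proof (rule eq_vecI)
    fix i assume "i < dim_vec (0\<^sub>v k :: real vec)"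
    hence i: "i < k" by simp
    have "(transpose_mat A *\<^sub>v unit_vec k s) $ i = transpose_mat A $$ (i, s)"
      using i less A by simp
    also have "\<dots> = 0" using i less by (simp add: A_def)
    finally show "(transpose_mat A *\<^sub>v unit_vec k s) $ i = 0\<^sub>v k $ i" using i by simp
  qed (use A in auto)
  moreover have "unit_vec k s \<noteq> (0\<^sub>v k :: real vec)"
    using less by (metis index_unit_vec(1) index_zero_vec(1) zero_neq_one)
  ultimately have "det (transpose_mat A) = 0"
    using A det_0_iff_vec_prod_zero[of "transpose_mat A" k] unit_vec_carrier[of k s]
    by (metis transpose_carrier_mat)
  hence "det A = 0" using A by (simp add: det_transpose)
  then obtain y where y: "y \<in> carrier_vec k" "y \<noteq> 0\<^sub>v k" "A *\<^sub>v y = 0\<^sub>v k"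
    using det_0_iff_vec_prod_zero[OF A] by auto
  have "B *\<^sub>v y = 0\<^sub>v s"
  proof (rule eq_vecI)
    fix i assume "i < dim_vec (0\<^sub>v s :: real vec)"
    hence i: "i < s" by simp
    have "(B *\<^sub>v y) $ i = (A *\<^sub>v y) $ i"
      using i less B y(1) by (auto simp: A_def scalar_prod_def intro!: sum.cong)
    thus "(B *\<^sub>v y) $ i = 0\<^sub>v s $ i" unfolding y(3) using i less by simp
  qed (use B in auto)
  thus ?thesis using that y by blast
qed

text \<open>The easy half of the Courant-Fischer principle. The columns of \<open>Q\<close> span the test space, on which \<open>C\<close> imposes \<open>r\<close>
  linear conditions. If fewer than \<open>k - r\<close> eigenvalues were at least \<open>c\<close>, then some nonzero test vector would
  satisfy these conditions and also be orthogonal to all eigenvectors of those eigenvalues; the quadratic form at this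
  vector would be too small.\<close>
lemma count_eigenvalues_ge:
  assumes d: "orth_diag N M U e"
    and Q: "Q \<in> carrier_mat N k" and C: "C \<in> carrier_mat r k"
    and large: "\<And>y. y \<in> carrier_vec k \<Longrightarrow> y \<noteq> 0\<^sub>v k \<Longrightarrow> C *\<^sub>v y = 0\<^sub>v r \<Longrightarrow>
       Q *\<^sub>v y \<noteq> 0\<^sub>v N \<and>
       c * ((Q *\<^sub>v y) \<bullet> (Q *\<^sub>v y)) \<le> (Q *\<^sub>v y) \<bullet> (M *\<^sub>v (Q *\<^sub>v y))"
  shows "k \<le> card {i. i < N \<and> c \<le> e i} + r"
proof (rule ccontr)
  let ?I = "{i. i < N \<and> c \<le> e i}"
  define s where "s = card ?I"
  assume "\<not> k \<le> card ?I + r"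
  hence less: "r + s < k" by (simp add: s_def)
  have U: "U \<in> carrier_mat N N" using d by (simp add: orth_diag_def)
  obtain g where g: "bij_betw g {0..<s} ?I"
    using ex_bij_betw_nat_finite[of ?I] by (auto simp: s_def)
  define T where "T = transpose_mat U * Q"
  have T: "T \<in> carrier_mat N k" using U Q by (simp add: T_def)
  \<comment> \<open>The conditions \<open>C\<close>, followed by orthogonality to the eigenvectors of the large eigenvalues.\<close>
  define B where "B = mat (r + s) k (\<lambda>(i, j). if i < r then C $$ (i, j) else T $$ (g (i - r), j))"
  have B: "B \<in> carrier_mat (r + s) k" by (simp add: B_def)
  obtain y where y: "y \<in> carrier_vec k" "y \<noteq> 0\<^sub>v k" "B *\<^sub>v y = 0\<^sub>v (r + s)"
    using homogeneous_system_nontrivial[OF B less] by blast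
  have "C *\<^sub>v y = 0\<^sub>v r"
  proof (rule eq_vecI)
    fix i assume "i < dim_vec (0\<^sub>v r :: real vec)"
    hence i: "i < r" by simp
    have "(C *\<^sub>v y) $ i = (B *\<^sub>v y) $ i"
      using i C y(1) by (auto simp: B_def scalar_prod_def intro!: sum.cong)
    thus "(C *\<^sub>v y) $ i = 0\<^sub>v r $ i" unfolding y(3) using i by simp
  qed (use C in auto)
  note lg = large[OF y(1,2) this]
  define x where "x = Q *\<^sub>v y"
  have x: "x \<in> carrier_vec N" using Q y by (simp add: x_def)
  define z where "z = transpose_mat U *\<^sub>v x"
  have zT: "z = T *\<^sub>v y"
    unfolding z_def x_def T_def using U Q y by (simp add: assoc_mult_mat_vec[of _ N N _ k])
  have z0: "z $ i = 0" if i: "i < N" "c \<le> e i" for i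
  proof -
    have "i \<in> g ` {0..<s}" using g i by (simp add: bij_betw_def)
    then obtain j where j: "j < s" "g j = i" by auto
    have "z $ i = (B *\<^sub>v y) $ (r + j)"
      unfolding zT using i j T y(1) by (auto simp: B_def scalar_prod_def intro!: sum.cong)
    thus ?thesis unfolding y(3) using j by simp
  qed
  have xx: "x \<bullet> x = (\<Sum>i\<in>{0..<N}. (z $ i)\<^sup>2)"
    unfolding z_def by (rule orth_diag_norm[OF d x])
  have "x \<bullet> x > 0" using scalar_prod_self_pos[OF x] lg by (simp add: x_def)
  then obtain i where i: "i < N" "z $ i \<noteq> 0"
    unfolding xx by (metis (no_types, lifting) atLeastLessThan_iff less_irrefl power_zero_numeral sum.neutral)
  have "x \<bullet> (M *\<^sub>v x) = (\<Sum>i\<in>{0..<N}. e i * (z $ i)\<^sup>2)"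
    unfolding z_def by (rule orth_diag_quadratic[OF d x])
  also have "\<dots> < (\<Sum>i\<in>{0..<N}. c * (z $ i)\<^sup>2)"
  proof (rule sum_strict_mono_ex1)
    show "\<forall>i\<in>{0..<N}. e i * (z $ i)\<^sup>2 \<le> c * (z $ i)\<^sup>2"
    proof
      fix i assume "i \<in> {0..<N}"
      thus "e i * (z $ i)\<^sup>2 \<le> c * (z $ i)\<^sup>2"
        using z0[of i] by (cases "c \<le> e i") (auto intro!: mult_right_mono)
    qed
    have "e i < c" using z0[of i] i by (meson not_le)
    thus "\<exists>i\<in>{0..<N}. e i * (z $ i)\<^sup>2 < c * (z $ i)\<^sup>2"
      using i by (intro bexI[of _ i]) auto
  qed simp
  also have "\<dots> = c * (x \<bullet> x)" unfolding xx by (simp add: sum_distrib_left)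
  finally show False using lg by (simp add: x_def)
qed

lemma nth_largest_ge:
  fixes xs :: "real list"
  assumes L: "L = rev (sort xs)"
    and j: "1 \<le> j" "j \<le> length xs"
    and count: "j \<le> length (filter (\<lambda>x. c \<le> x) xs)"
  shows "c \<le> L ! (j - 1)"
proof (rule ccontr)
  assume neg: "\<not> c \<le> L ! (j - 1)"
  have desc: "L ! b \<le> L ! a" if "a \<le> b" "b < length L" for a b
    using that sorted_rev_nth_mono[of L a b] by (simp add: L)
  have len: "length L = length xs" by (simp add: L)
  have "filter (\<lambda>x. c \<le> x) (drop (j - 1) L) = []"
  proof -
    have "\<not> c \<le> x" if x: "x \<in> set (drop (j - 1) L)" for x
    proof -
      obtain i where i: "i < length (drop (j - 1) L)" "x = drop (j - 1) L ! i"
        using x by (auto simp: in_set_conv_nth)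
      hence "x \<le> L ! (j - 1)" using desc[of "j - 1" "j - 1 + i"] by simp
      thus ?thesis using neg by simp
    qed
    thus ?thesis by (simp add: filter_empty_conv)
  qed
  moreover have "filter (\<lambda>x. c \<le> x) L =
      filter (\<lambda>x. c \<le> x) (take (j - 1) L) @ filter (\<lambda>x. c \<le> x) (drop (j - 1) L)"
    by (metis append_take_drop_id filter_append)
  ultimately have "length (filter (\<lambda>x. c \<le> x) L) \<le> j - 1"
    using length_filter_le[of "\<lambda>x. c \<le> x" "take (j - 1) L"] by simp
  moreover have "length (filter (\<lambda>x. c \<le> x) L) = length (filter (\<lambda>x. c \<le> x) xs)"
    by (metis L mset_filter mset_rev mset_sort size_mset)
  ultimately show False using count j by simp
qed

lemma nth_smallest_le:
  fixes xs :: "real list"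
  assumes L: "L = rev (sort xs)"
    and j: "1 \<le> j" "j \<le> length xs"
    and count: "j \<le> length (filter (\<lambda>x. x \<le> c) xs)"
  shows "L ! (length xs - j) \<le> c"
proof (rule ccontr)
  let ?m = "Suc (length xs - j)"
  assume neg: "\<not> L ! (length xs - j) \<le> c"
  have desc: "L ! b \<le> L ! a" if "a \<le> b" "b < length L" for a b
    using that sorted_rev_nth_mono[of L a b] by (simp add: L)
  have len: "length L = length xs" by (simp add: L)
  have "filter (\<lambda>x. x \<le> c) (take ?m L) = []"
  proof -
    have "\<not> x \<le> c" if x: "x \<in> set (take ?m L)" for x
    proof -
      obtain i where i: "i < length (take ?m L)" "x = take ?m L ! i"
        using x by (auto simp: in_set_conv_nth)
      hence "L ! (length xs - j) \<le> x" using desc[of i "length xs - j"] len j by simp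
      thus ?thesis using neg by simp
    qed
    thus ?thesis by (simp add: filter_empty_conv)
  qed
  moreover have "filter (\<lambda>x. x \<le> c) L =
      filter (\<lambda>x. x \<le> c) (take ?m L) @ filter (\<lambda>x. x \<le> c) (drop ?m L)"
    by (metis append_take_drop_id filter_append)
  ultimately have "length (filter (\<lambda>x. x \<le> c) L) \<le> length (drop ?m L)"
    using length_filter_le[of "\<lambda>x. x \<le> c" "drop ?m L"] by simp
  moreover have "length (drop ?m L) < j" using len j by simp
  moreover have "length (filter (\<lambda>x. x \<le> c) L) = length (filter (\<lambda>x. x \<le> c) xs)"
    by (metis L mset_filter mset_rev mset_sort size_mset)
  ultimately show False using count by simp
qed

lemma adj_mat_carrier: "adj_mat n E \<in> carrier_mat n n"
  by (simp add: adj_mat_def)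

lemma adj_mat_symmetric: "transpose_mat (adj_mat n E) = adj_mat n E"
  by (rule eq_matI) (auto simp: adj_mat_def insert_commute)

lemma graph_eigenvalue_orth_diag:
  assumes "orth_diag n (adj_mat n E) U e"
  shows "graph_eigenvalue n E j = rev (sort (map e [0..<n])) ! (j - 1)"
  unfolding graph_eigenvalue_def proots_orth_diag[OF assms]
  by (simp only: sorted_list_of_multiset_mset)

lemma card_eq_length_filter:
  "length (filter P (map e [0..<n])) = card {i. i < n \<and> P (e i)}"
proof -
  have "length (filter P (map e [0..<n])) = length (filter (\<lambda>i. P (e i)) [0..<n])"
    by (simp add: filter_map comp_def)
  also have "\<dots> = card (set (filter (\<lambda>i. P (e i)) [0..<n]))"
    by (rule distinct_card[symmetric]) simp
  also have "set (filter (\<lambda>i. P (e i)) [0..<n]) = {i. i < n \<and> P (e i)}" by auto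
  finally show ?thesis .
qed

text \<open>The quadratic form of a matrix with entries in \<open>[-1, 1]\<close> at a unit vector \<open>x\<close> is bounded by the sum of the
  \<open>\<bar>x $ i\<bar> \<bar>x $ j\<bar>\<close>, hence by \<open>n\<close>. This makes the sets of the suprema defining \<^const>\<open>eig_const\<close> bounded, so that a
  single graph gives a lower bound.\<close>
lemma orth_diag_entry_bound:
  assumes d: "orth_diag n A U e" and A: "\<And>i j. i < n \<Longrightarrow> j < n \<Longrightarrow> \<bar>A $$ (i, j)\<bar> \<le> 1"
    and k: "k < n"
  shows "\<bar>e k\<bar> \<le> real n"
proof -
  have U: "U \<in> carrier_mat n n" and UU: "transpose_mat U * U = 1\<^sub>m n"
    using d by (auto simp: orth_diag_def)
  have Ac: "A \<in> carrier_mat n n" by (rule orth_diag_carrier[OF d])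
  define x where "x = col U k"
  have x: "x \<in> carrier_vec n" using U k by (simp add: x_def)
  have z: "transpose_mat U *\<^sub>v x = unit_vec n k"
  proof (rule eq_vecI)
    fix i assume "i < dim_vec (unit_vec n k :: real vec)"
    hence i: "i < n" by simp
    have "(transpose_mat U *\<^sub>v x) $ i = (transpose_mat U * U) $$ (i, k)"
      using i k U by (simp add: x_def)
    thus "(transpose_mat U *\<^sub>v x) $ i = unit_vec n k $ i" unfolding UU using i k by simp
  qed (use U in auto)
  have one: "(\<Sum>i\<in>{0..<n}. (x $ i)\<^sup>2) = 1"
  proof -
    have "(\<Sum>i\<in>{0..<n}. (x $ i)\<^sup>2) = x \<bullet> x" using x by (simp add: scalar_prod_def power2_eq_square)
    also have "\<dots> = (\<Sum>i\<in>{0..<n}. (unit_vec n k $ i :: real)\<^sup>2)"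
      using orth_diag_norm[OF d x] unfolding z .
    also have "\<dots> = (\<Sum>i\<in>{0..<n}. if i = k then 1 else 0)"
      using k by (intro sum.cong) auto
    finally show ?thesis using k by simp
  qed
  have "e k = (\<Sum>i\<in>{0..<n}. if i = k then e k else 0)" using k by simp
  also have "\<dots> = (\<Sum>i\<in>{0..<n}. e i * (unit_vec n k $ i)\<^sup>2)"
    using k by (intro sum.cong) auto
  also have "\<dots> = x \<bullet> (A *\<^sub>v x)" using orth_diag_quadratic[OF d x] unfolding z by simp
  also have "\<dots> = (\<Sum>i\<in>{0..<n}. \<Sum>j\<in>{0..<n}. x $ i * (A $$ (i, j) * x $ j))"
    using x Ac by (simp add: scalar_prod_def sum_distrib_left)
  finally have "\<bar>e k\<bar> = \<bar>\<Sum>i\<in>{0..<n}. \<Sum>j\<in>{0..<n}. x $ i * (A $$ (i, j) * x $ j)\<bar>" by simp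
  also have "\<dots> \<le> (\<Sum>i\<in>{0..<n}. \<Sum>j\<in>{0..<n}. ((x $ i)\<^sup>2 + (x $ j)\<^sup>2) / 2)"
  proof (intro order_trans[OF sum_abs] sum_mono)
    fix i j assume "i \<in> {0..<n}" "j \<in> {0..<n}"
    hence "\<bar>A $$ (i, j)\<bar> * \<bar>x $ j\<bar> \<le> 1 * \<bar>x $ j\<bar>"
      using A by (intro mult_right_mono) auto
    hence "\<bar>x $ i * (A $$ (i, j) * x $ j)\<bar> \<le> \<bar>x $ i\<bar> * \<bar>x $ j\<bar>"
      by (simp add: abs_mult mult_left_mono)
    also have "\<dots> \<le> ((x $ i)\<^sup>2 + (x $ j)\<^sup>2) / 2"
      using sum_squares_bound[of "\<bar>x $ i\<bar>" "\<bar>x $ j\<bar>"] by simp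
    finally show "\<bar>x $ i * (A $$ (i, j) * x $ j)\<bar> \<le> ((x $ i)\<^sup>2 + (x $ j)\<^sup>2) / 2" .
  qed
  also have "\<dots> = real n * (\<Sum>i\<in>{0..<n}. (x $ i)\<^sup>2)"
    by (simp add: sum_divide_distrib[symmetric] sum.distrib sum_distrib_left[symmetric])
  also have "\<dots> = real n" using one by simp
  finally show ?thesis .
qed

lemma graph_eigenvalue_bound:
  assumes j: "1 \<le> j" "j \<le> n"
  shows "\<bar>graph_eigenvalue n E j\<bar> \<le> real n"
proof -
  obtain U e where d: "orth_diag n (adj_mat n E) U e"
    using spectral_theorem_real_symmetric[OF adj_mat_carrier adj_mat_symmetric] by blast
  let ?L = "rev (sort (map e [0..<n]))"
  have "?L ! (j - 1) \<in> set ?L" by (rule nth_mem) (use j in auto)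
  then obtain i where i: "i < n" "?L ! (j - 1) = e i" by auto
  have "\<bar>e i\<bar> \<le> real n"
    by (rule orth_diag_entry_bound[OF d _ i(1)]) (simp add: adj_mat_def)
  thus ?thesis unfolding graph_eigenvalue_orth_diag[OF d] i(2) .
qed

lemma eig_const_pos_ge:
  assumes "simple_graph n E" "1 \<le> k" "k \<le> n"
  shows "graph_eigenvalue n E k / real n \<le> eig_const (int k)"
proof -
  let ?S = "{graph_eigenvalue n E k / real n | n E. simple_graph n E \<and> k \<le> n}"
  have "bdd_above ?S"
  proof (rule bdd_aboveI[of _ 1])
    fix x assume "x \<in> ?S"
    then obtain n E where x: "x = graph_eigenvalue n E k / real n" "k \<le> n" by auto
    thus "x \<le> 1" using graph_eigenvalue_bound[of k n E] assms(2) by (simp add: divide_le_eq)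
  qed
  hence "graph_eigenvalue n E k / real n \<le> Sup ?S" using assms by (intro cSup_upper) auto
  thus ?thesis using assms(2) by (simp add: eig_const_def Let_def)
qed

lemma eig_const_neg_ge:
  assumes "simple_graph n E" "1 \<le> j" "j \<le> n"
  shows "\<bar>graph_eigenvalue n E (n - j + 1)\<bar> / real n \<le> eig_const (- int j)"
proof -
  let ?S = "{\<bar>graph_eigenvalue n E (n - j + 1)\<bar> / real n | n E. simple_graph n E \<and> j \<le> n}"
  have "bdd_above ?S"
  proof (rule bdd_aboveI[of _ 1])
    fix x assume "x \<in> ?S"
    then obtain n E where x: "x = \<bar>graph_eigenvalue n E (n - j + 1)\<bar> / real n" "j \<le> n" by auto
    thus "x \<le> 1" using graph_eigenvalue_bound[of "n - j + 1" n E] assms(2) by (simp add: divide_le_eq)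
  qed
  hence "\<bar>graph_eigenvalue n E (n - j + 1)\<bar> / real n \<le> Sup ?S" using assms by (intro cSup_upper) auto
  thus ?thesis using assms(2) by (simp add: eig_const_def Let_def)
qed

lemma quadratic_form_sum:
  fixes A :: "real mat"
  assumes "A \<in> carrier_mat n n" "x \<in> carrier_vec n"
  shows "x \<bullet> (A *\<^sub>v x) = (\<Sum>a\<in>{0..<n}. \<Sum>b\<in>{0..<n}. A $$ (a, b) * (x $ a * x $ b))"
  using assms by (simp add: scalar_prod_def sum_distrib_left mult_ac)

lemma orth_diag_mult_col:
  assumes d: "orth_diag n A U e" and i: "i < n"
  shows "A *\<^sub>v col U i = e i \<cdot>\<^sub>v col U i"
proof -
  have U: "U \<in> carrier_mat n n" and UU: "transpose_mat U * U = 1\<^sub>m n"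
    and A: "A = U * mat_diag n e * transpose_mat U"
    using d by (auto simp: orth_diag_def)
  have c: "U * mat_diag n e \<in> carrier_mat n n" by (rule mult_carrier_mat[OF U mat_diag_dim])
  have "A * U = U * mat_diag n e * (transpose_mat U * U)"
    unfolding A by (rule assoc_mult_mat[of _ n n _ n _ n]) (use U c in auto)
  also have "\<dots> = U * mat_diag n e" unfolding UU by (rule right_mult_one_mat[OF c])
  also have "\<dots> = mat n n (\<lambda>(a, j). U $$ (a, j) * e j)" by (rule mat_diag_mult_right[OF U])
  finally have AU: "A * U = mat n n (\<lambda>(a, j). U $$ (a, j) * e j)" .
  have "A *\<^sub>v col U i = col (A * U) i"
    using i U orth_diag_carrier[OF d] by (intro eq_vecI) auto
  thus ?thesis unfolding AU using i U by (intro eq_vecI) auto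
qed

lemma orth_diag_col_orthonormal:
  assumes d: "orth_diag n A U e" and ij: "i < n" "j < n"
  shows "(\<Sum>a\<in>{0..<n}. U $$ (a, i) * U $$ (a, j)) = (if i = j then 1 else 0)"
proof -
  have U: "U \<in> carrier_mat n n" and UU: "transpose_mat U * U = 1\<^sub>m n"
    using d by (auto simp: orth_diag_def)
  have "(\<Sum>a\<in>{0..<n}. U $$ (a, i) * U $$ (a, j)) = (transpose_mat U * U) $$ (i, j)"
    using ij U by (simp add: scalar_prod_def)
  thus ?thesis unfolding UU using ij by simp
qed

lemma orth_diag_trace:
  assumes d: "orth_diag n A U e"
  shows "(\<Sum>a\<in>{0..<n}. A $$ (a, a)) = (\<Sum>i\<in>{0..<n}. e i)"
proof -
  have U: "U \<in> carrier_mat n n" and A: "A = U * mat_diag n e * transpose_mat U"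
    using d by (auto simp: orth_diag_def)
  have "A $$ (a, a) = (\<Sum>i\<in>{0..<n}. e i * (U $$ (a, i) * U $$ (a, i)))" if a: "a < n" for a
    unfolding A mat_diag_mult_right[OF U] using a U by (simp add: scalar_prod_def mult_ac)
  hence "(\<Sum>a\<in>{0..<n}. A $$ (a, a)) = (\<Sum>a\<in>{0..<n}. \<Sum>i\<in>{0..<n}. e i * (U $$ (a, i) * U $$ (a, i)))"
    by (intro sum.cong) auto
  also have "\<dots> = (\<Sum>i\<in>{0..<n}. e i * (\<Sum>a\<in>{0..<n}. U $$ (a, i) * U $$ (a, i)))"
    by (subst sum.swap) (simp add: sum_distrib_left)
  also have "\<dots> = (\<Sum>i\<in>{0..<n}. e i)"
    by (intro sum.cong) (auto simp: orth_diag_col_orthonormal[OF d])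
  finally show ?thesis .
qed

section \<open>The spectrum of the unitary Seidel matrix\<close>
context unitary_seidel_matrix
begin

definition seidel_mat :: "real mat" where "seidel_mat = mat n n (\<lambda>(x, y). real_of_int (S x y))"

definition top_mult :: nat where "top_mult = q\<^sup>2 - q + 1"

lemma seidel_mat_carrier: "seidel_mat \<in> carrier_mat n n"
  by (simp add: seidel_mat_def)

lemma seidel_mat_symmetric: "transpose_mat seidel_mat = seidel_mat"
  by (rule eq_matI) (auto simp: seidel_mat_def S_sym)

lemma seidel_mat_square: "seidel_mat * seidel_mat = (real q ^ 2 - real q) \<cdot>\<^sub>m seidel_mat + real q ^ 3 \<cdot>\<^sub>m 1\<^sub>m n"
proof (rule eq_matI)
  fix x y assume "x < dim_row ((real q ^ 2 - real q) \<cdot>\<^sub>m seidel_mat + real q ^ 3 \<cdot>\<^sub>m 1\<^sub>m n)"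
    "y < dim_col ((real q ^ 2 - real q) \<cdot>\<^sub>m seidel_mat + real q ^ 3 \<cdot>\<^sub>m 1\<^sub>m n)"
  hence xy: "x < n" "y < n" by auto
  have "(seidel_mat * seidel_mat) $$ (x, y) = (\<Sum>z\<in>{0..<n}. real_of_int (S x z) * real_of_int (S z y))"
    using xy by (simp add: seidel_mat_def scalar_prod_def)
  also have "\<dots> = real_of_int (\<Sum>z<n. S x z * S z y)"
    by (simp add: atLeast0LessThan)
  finally show "(seidel_mat * seidel_mat) $$ (x, y) = ((real q ^ 2 - real q) \<cdot>\<^sub>m seidel_mat + real q ^ 3 \<cdot>\<^sub>m 1\<^sub>m n) $$ (x, y)"
    unfolding S_square[OF xy] using xy by (simp add: seidel_mat_def)
qed (auto simp: seidel_mat_def)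

lemma eigenvalue_cases:
  assumes d: "orth_diag n seidel_mat U e" and i: "i < n"
  shows "e i = real q ^ 2 \<or> e i = - real q"
proof -
  define x where "x = col U i"
  have U: "U \<in> carrier_mat n n" using d by (simp add: orth_diag_def)
  have x: "x \<in> carrier_vec n" using U i by (simp add: x_def)
  have ev: "seidel_mat *\<^sub>v x = e i \<cdot>\<^sub>v x" unfolding x_def by (rule orth_diag_mult_col[OF d i])
  have "e i * e i * x $ a = ((real q ^ 2 - real q) * e i + real q ^ 3) * x $ a" if a: "a < n" for a
  proof -
    have "(seidel_mat * seidel_mat) *\<^sub>v x = seidel_mat *\<^sub>v (seidel_mat *\<^sub>v x)"
      by (rule assoc_mult_mat_vec[OF seidel_mat_carrier seidel_mat_carrier x])
    also have "\<dots> = e i \<cdot>\<^sub>v (e i \<cdot>\<^sub>v x)"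
      unfolding ev using mult_mat_vec[OF seidel_mat_carrier x] ev by simp
    finally have 1: "((seidel_mat * seidel_mat) *\<^sub>v x) $ a = e i * e i * x $ a" using a x by simp
    have "((seidel_mat * seidel_mat) *\<^sub>v x) $ a = (((real q ^ 2 - real q) \<cdot>\<^sub>m seidel_mat) *\<^sub>v x + (real q ^ 3 \<cdot>\<^sub>m 1\<^sub>m n) *\<^sub>v x) $ a"
      unfolding seidel_mat_square using x seidel_mat_carrier by (subst add_mult_distrib_mat_vec[of _ n n]) auto
    also have "\<dots> = (real q ^ 2 - real q) * (seidel_mat *\<^sub>v x) $ a + real q ^ 3 * x $ a"
      using a x seidel_mat_carrier by simp
    also have "\<dots> = ((real q ^ 2 - real q) * e i + real q ^ 3) * x $ a"
      unfolding ev using a x by (simp add: algebra_simps)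
    finally show ?thesis using 1 by simp
  qed
  hence eq: "(e i * e i - ((real q ^ 2 - real q) * e i + real q ^ 3)) * x $ a = 0" if "a < n" for a
    using that by (simp add: algebra_simps)
  have "(\<Sum>a\<in>{0..<n}. x $ a * x $ a) = 1"
    using orth_diag_col_orthonormal[OF d i i] i U by (simp add: x_def)
  then obtain a where a: "a < n" "x $ a \<noteq> 0"
    by (metis (no_types, lifting) atLeastLessThan_iff mult_zero_left sum.neutral zero_neq_one)
  have "(e i - real q ^ 2) * (e i + real q) = e i * e i - ((real q ^ 2 - real q) * e i + real q ^ 3)"
    by (simp add: algebra_simps power2_eq_square power3_eq_cube)
  also have "\<dots> = 0" using eq[OF a(1)] a(2) by simp
  finally have "(e i - real q ^ 2) * (e i + real q) = 0" .
  thus ?thesis by (auto simp: add_eq_0_iff)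
qed

text \<open>With multiplicity \<open>m\<close> of \<open>q\<^sup>2\<close>, the vanishing trace gives \<open>m q\<^sup>2 = (n - m) q\<close>, that is,
  \<open>m (q + 1) = n = q\<^sup>3 + 1\<close>.\<close>
lemma card_positive_eigenvalues:
  assumes d: "orth_diag n seidel_mat U e"
  shows "card {i. i < n \<and> e i = real q ^ 2} = top_mult"
proof -
  let ?P = "{i. i < n \<and> e i = real q ^ 2}"
  define m where "m = card ?P"
  have "(\<Sum>a\<in>{0..<n}. seidel_mat $$ (a, a)) = 0" by (simp add: seidel_mat_def S_diag)
  hence "0 = (\<Sum>i\<in>{0..<n}. e i)" using orth_diag_trace[OF d] by simp
  also have "\<dots> = (\<Sum>i\<in>{0..<n}. (if e i = real q ^ 2 then real q ^ 2 + real q else 0) - real q)"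
    using eigenvalue_cases[OF d] by (intro sum.cong) auto
  also have "\<dots> = real m * (real q ^ 2 + real q) - real n * real q"
  proof -
    have "{0..<n} \<inter> {i. e i = real q ^ 2} = ?P" by auto
    thus ?thesis by (simp add: sum_subtractf sum.If_cases m_def)
  qed
  finally have "real q * (real m * (real q + 1)) = real q * real n"
    by (simp add: algebra_simps power2_eq_square)
  hence "real m * (real q + 1) = real n" using q by simp
  hence "real (m * (q + 1)) = real n" by (simp add: algebra_simps)
  hence "m * (q + 1) = q ^ 3 + 1" unfolding n of_nat_eq_iff .
  moreover have "top_mult * (q + 1) = q ^ 3 + 1"
  proof -
    have "q \<le> q\<^sup>2" by (simp add: power2_eq_square)
    hence "int (top_mult * (q + 1)) = int (q ^ 3 + 1)"
      by (simp add: top_mult_def of_nat_diff algebra_simps power2_eq_square power3_eq_cube)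
    thus ?thesis by linarith
  qed
  ultimately show ?thesis unfolding m_def by (metis Suc_eq_plus1 mult_cancel2 nat.simps(3))
qed

text \<open>The columns of \<open>V\<close> are an orthonormal basis of the eigenspace for \<open>q\<^sup>2\<close>.\<close>
lemma top_eigenspace:
  obtains V where "V \<in> carrier_mat n top_mult"
    and "\<And>y. y \<in> carrier_vec top_mult \<Longrightarrow> (V *\<^sub>v y) \<bullet> (V *\<^sub>v y) = y \<bullet> y"
    and "\<And>y. y \<in> carrier_vec top_mult \<Longrightarrow> seidel_mat *\<^sub>v (V *\<^sub>v y) = real q ^ 2 \<cdot>\<^sub>v (V *\<^sub>v y)"
proof -
  let ?k = top_mult
  obtain U e where d: "orth_diag n seidel_mat U e"
    using spectral_theorem_real_symmetric[OF seidel_mat_carrier seidel_mat_symmetric] by blast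
  have U: "U \<in> carrier_mat n n" using d by (simp add: orth_diag_def)
  let ?P = "{i. i < n \<and> e i = real q ^ 2}"
  obtain g where g: "bij_betw g {0..<?k} ?P"
    using ex_bij_betw_nat_finite[of ?P] card_positive_eigenvalues[OF d] by auto
  have gP: "g j < n" "e (g j) = real q ^ 2" if "j < ?k" for j
    using g that by (auto simp: bij_betw_def)
  have gi: "g i = g j \<longleftrightarrow> i = j" if "i < ?k" "j < ?k" for i j
    using g that by (auto simp: bij_betw_def inj_on_eq_iff)
  define V where "V = mat n ?k (\<lambda>(a, j). U $$ (a, g j))"
  have V: "V \<in> carrier_mat n ?k" by (simp add: V_def)
  have VV: "transpose_mat V * V = 1\<^sub>m ?k"
  proof (rule eq_matI)
    fix i j assume "i < dim_row (1\<^sub>m ?k :: real mat)" "j < dim_col (1\<^sub>m ?k :: real mat)"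
    hence ij: "i < ?k" "j < ?k" by auto
    have "(transpose_mat V * V) $$ (i, j) = (\<Sum>a\<in>{0..<n}. U $$ (a, g i) * U $$ (a, g j))"
      using ij by (simp add: V_def scalar_prod_def)
    thus "(transpose_mat V * V) $$ (i, j) = 1\<^sub>m ?k $$ (i, j)"
      using orth_diag_col_orthonormal[OF d gP(1)[OF ij(1)] gP(1)[OF ij(2)]] ij gi[OF ij] by simp
  qed (use V in auto)
  have SV: "seidel_mat * V = real q ^ 2 \<cdot>\<^sub>m V"
  proof (rule eq_matI)
    fix a j assume "a < dim_row (real q ^ 2 \<cdot>\<^sub>m V)" "j < dim_col (real q ^ 2 \<cdot>\<^sub>m V)"
    hence aj: "a < n" "j < ?k" using V by auto
    have cV: "col V j = col U (g j)" using aj gP[OF aj(2)] U by (intro eq_vecI) (auto simp: V_def)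
    have "(seidel_mat * V) $$ (a, j) = (seidel_mat *\<^sub>v col U (g j)) $ a"
      using aj V seidel_mat_carrier by (simp add: cV)
    also have "\<dots> = real q ^ 2 * U $$ (a, g j)"
      unfolding orth_diag_mult_col[OF d gP(1)[OF aj(2)]] using aj gP[OF aj(2)] U by simp
    finally show "(seidel_mat * V) $$ (a, j) = (real q ^ 2 \<cdot>\<^sub>m V) $$ (a, j)" using aj by (simp add: V_def)
  qed (use V seidel_mat_carrier in auto)
  show ?thesis
  proof (rule that[OF V])
    fix y :: "real vec" assume y: "y \<in> carrier_vec ?k"
    have Vy: "V *\<^sub>v y \<in> carrier_vec n" using V y by simp
    have "(V *\<^sub>v y) \<bullet> (V *\<^sub>v y) = (transpose_mat V *\<^sub>v (V *\<^sub>v y)) \<bullet> y"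
      using transpose_vec_mult_scalar[OF V y Vy] by simp
    also have "transpose_mat V *\<^sub>v (V *\<^sub>v y) = y"
      using assoc_mult_mat_vec[of "transpose_mat V" ?k n V ?k y] V y by (simp add: VV)
    finally show "(V *\<^sub>v y) \<bullet> (V *\<^sub>v y) = y \<bullet> y" .
    have "seidel_mat *\<^sub>v (V *\<^sub>v y) = (seidel_mat * V) *\<^sub>v y"
      by (rule assoc_mult_mat_vec[OF seidel_mat_carrier V y, symmetric])
    thus "seidel_mat *\<^sub>v (V *\<^sub>v y) = real q ^ 2 \<cdot>\<^sub>v (V *\<^sub>v y)"
      unfolding SV using V y by (intro eq_vecI) auto
  qed
qed


lemma seidel_mat_quadratic:
  assumes w: "w \<in> carrier_vec n" and ev: "seidel_mat *\<^sub>v w = c \<cdot>\<^sub>v w"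
  shows "(\<Sum>a\<in>{0..<n}. \<Sum>b\<in>{0..<n}. real_of_int (S a b) * (w $ a * w $ b)) = c * (w \<bullet> w)"
proof -
  have "(\<Sum>a\<in>{0..<n}. \<Sum>b\<in>{0..<n}. real_of_int (S a b) * (w $ a * w $ b)) = w \<bullet> (seidel_mat *\<^sub>v w)"
    unfolding quadratic_form_sum[OF seidel_mat_carrier w] by (simp add: seidel_mat_def)
  thus ?thesis unfolding ev using w by simp
qed

lemma identity_quadratic:
  assumes w: "w \<in> carrier_vec n"
  shows "(\<Sum>a\<in>{0..<n}. \<Sum>b\<in>{0..<n}. (if a = b then 1 else 0) * (w $ a * w $ b)) = (w \<bullet> w :: real)"
proof -
  have "(\<Sum>a\<in>{0..<n}. \<Sum>b\<in>{0..<n}. (if a = b then 1 else 0) * (w $ a * w $ b))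
      = (\<Sum>a\<in>{0..<n}. \<Sum>b\<in>{0..<n}. if b = a then w $ a * w $ a else 0)"
    by (intro sum.cong) auto
  thus ?thesis using w by (simp add: scalar_prod_def)
qed

lemma top_mult_le: "1 < top_mult" "top_mult \<le> n"
proof -
  have "q * 2 \<le> q * q" using q by (intro mult_left_mono) auto
  thus "1 < top_mult" using q by (simp add: top_mult_def power2_eq_square)
  have "q\<^sup>2 \<le> q ^ 3" using q by (intro power_increasing) auto
  thus "top_mult \<le> n" by (simp add: top_mult_def n)
qed

section \<open>The two graphs\<close>
definition neg_edges :: "nat set set" where
  "neg_edges = {{u, v} | u v. u < n \<and> v < n \<and> S u v = -1}"

lemma simple_neg_edges: "simple_graph n neg_edges"
proof -
  have "u \<noteq> v" if "u < n" "S u v = -1" for u v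
    using S_diag[of u] that by auto
  thus ?thesis by (auto simp: simple_graph_def neg_edges_def)
qed

lemma adj_mat_neg_edges:
  assumes uv: "u < n" "v < n"
  shows "adj_mat n neg_edges $$ (u, v) = (1 - real_of_int (S u v) - (if u = v then 1 else 0)) / 2"
proof -
  have "{u, v} \<in> neg_edges \<longleftrightarrow> S u v = -1"
    using uv S_sym by (auto simp: neg_edges_def doubleton_eq_iff)
  thus ?thesis using uv S_diag[of u] S_off[of u v] by (auto simp: adj_mat_def)
qed

text \<open>The adjacency matrix is \<open>(J - S - I) / 2\<close>. The test space is the eigenspace of \<open>S\<close> for \<open>q\<^sup>2\<close>, and the one linear
  condition \<open>C\<close> says that the entries of the test vector sum to zero, which removes \<open>J\<close>.\<close>
lemma neg_graph_eigenvalue: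
  "graph_eigenvalue n neg_edges (n - (top_mult - 1) + 1) \<le> - (real q ^ 2 + 1) / 2"
proof -
  let ?k = top_mult let ?A = "adj_mat n neg_edges"
  let ?c = "(real q ^ 2 + 1) / 2"
  obtain V where V: "V \<in> carrier_mat n ?k"
    and iso: "\<And>y. y \<in> carrier_vec ?k \<Longrightarrow> (V *\<^sub>v y) \<bullet> (V *\<^sub>v y) = y \<bullet> y"
    and ev: "\<And>y. y \<in> carrier_vec ?k \<Longrightarrow> seidel_mat *\<^sub>v (V *\<^sub>v y) = real q ^ 2 \<cdot>\<^sub>v (V *\<^sub>v y)"
    using top_eigenspace by blast
  obtain U e where d: "orth_diag n ?A U e"
    using spectral_theorem_real_symmetric[OF adj_mat_carrier adj_mat_symmetric] by blast
  define C where "C = mat 1 ?k (\<lambda>(_, j). \<Sum>a\<in>{0..<n}. V $$ (a, j))"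
  have "?k \<le> card {i. i < n \<and> ?c \<le> - e i} + 1"
  proof (rule count_eigenvalues_ge[OF orth_diag_uminus[OF d] V])
    show "C \<in> carrier_mat 1 ?k" by (simp add: C_def)
    fix y assume y: "y \<in> carrier_vec ?k" "y \<noteq> 0\<^sub>v ?k" "C *\<^sub>v y = 0\<^sub>v 1"
    define w where "w = V *\<^sub>v y"
    have w: "w \<in> carrier_vec n" using V y by (simp add: w_def)
    have "w \<bullet> w > 0" using iso[OF y(1)] scalar_prod_self_pos[OF y(1,2)] by (simp add: w_def)
    hence "w \<noteq> 0\<^sub>v n" by auto
    have "(\<Sum>a\<in>{0..<n}. w $ a) = (\<Sum>a\<in>{0..<n}. \<Sum>j\<in>{0..<?k}. V $$ (a, j) * y $ j)"
      using V y(1) by (simp add: w_def scalar_prod_def)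
    also have "\<dots> = (\<Sum>j\<in>{0..<?k}. (\<Sum>a\<in>{0..<n}. V $$ (a, j)) * y $ j)"
      by (subst sum.swap) (simp add: sum_distrib_right)
    also have "\<dots> = (C *\<^sub>v y) $ 0"
      using y(1) by (simp add: C_def scalar_prod_def)
    finally have s0: "(\<Sum>a\<in>{0..<n}. w $ a) = 0" unfolding y(3) by simp
    have "w \<bullet> (- ?A *\<^sub>v w) = (\<Sum>a\<in>{0..<n}. \<Sum>b\<in>{0..<n}.
        (real_of_int (S a b) * (w $ a * w $ b) + (if a = b then 1 else 0) * (w $ a * w $ b)
          - w $ a * w $ b) / 2)"
      using w adj_mat_carrier[of n neg_edges]
      by (subst quadratic_form_sum[of _ n])
         (auto simp: adj_mat_neg_edges field_simps intro!: sum.cong)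
    also have "\<dots> = (real q ^ 2 * (w \<bullet> w) + w \<bullet> w - (\<Sum>a\<in>{0..<n}. \<Sum>b\<in>{0..<n}. w $ a * w $ b)) / 2"
      using seidel_mat_quadratic[OF w, of "real q ^ 2"] ev[OF y(1)] identity_quadratic[OF w]
      by (simp only: sum_divide_distrib[symmetric] sum.distrib sum_subtractf w_def)
    also have "(\<Sum>a\<in>{0..<n}. \<Sum>b\<in>{0..<n}. w $ a * w $ b) = (\<Sum>a\<in>{0..<n}. w $ a) * (\<Sum>b\<in>{0..<n}. w $ b)"
      by (simp add: sum_product)
    finally have "w \<bullet> (- ?A *\<^sub>v w) = ?c * (w \<bullet> w)" unfolding s0 by (simp add: algebra_simps)
    thus "V *\<^sub>v y \<noteq> 0\<^sub>v n \<and> ?c * ((V *\<^sub>v y) \<bullet> (V *\<^sub>v y)) \<le> (V *\<^sub>v y) \<bullet> (- ?A *\<^sub>v (V *\<^sub>v y))"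
      using \<open>w \<noteq> 0\<^sub>v n\<close> by (simp add: w_def)
  qed
  also have "{i. i < n \<and> ?c \<le> - e i} = {i. i < n \<and> e i \<le> - (real q ^ 2 + 1) / 2}"
    by (auto simp: field_simps)
  finally have count: "?k - 1 \<le> length (filter (\<lambda>x. x \<le> - (real q ^ 2 + 1) / 2) (map e [0..<n]))"
    unfolding card_eq_length_filter by simp
  have "rev (sort (map e [0..<n])) ! (length (map e [0..<n]) - (?k - 1)) \<le> - (real q ^ 2 + 1) / 2"
    by (rule nth_smallest_le[OF refl _ _ count]) (use top_mult_le in auto)
  thus ?thesis unfolding graph_eigenvalue_orth_diag[OF d] by simp
qed

lemma sum_div_four:
  fixes f :: "nat \<Rightarrow> real"
  shows "(\<Sum>a\<in>{0..<4 * m}. f (a div 4)) = 4 * (\<Sum>u\<in>{0..<m}. f u)"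
proof (induction m)
  case (Suc m)
  have *: "{0..<4 * Suc m} = {0..<4 * m} \<union> {4 * m, 4 * m + 1, 4 * m + 2, 4 * m + 3}" by auto
  have "(\<Sum>a\<in>{0..<4 * Suc m}. f (a div 4)) = (\<Sum>a\<in>{0..<4 * m}. f (a div 4)) + 4 * f m"
  proof -
    have "f ((4 * m + 0) div 4) = f m" "f ((4 * m + 1) div 4) = f m"
      "f ((4 * m + 2) div 4) = f m" "f ((4 * m + 3) div 4) = f m"
      by (subst div_mult_self4; simp)+
    thus ?thesis using * by (simp add: sum.union_disjoint)
  qed
  thus ?case using Suc by simp
qed simp

text \<open>Vertex \<open>a\<close> is a copy of the point \<open>a div 4\<close>. Copies of one point are adjacent. The loss of \<open>1\<close> caused by
  removing the loops weighs less for larger cliques, and \<open>4\<close> is the least size for which the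
  resulting bound is good enough when \<open>q = 3\<close>.\<close>
definition blowup_edges :: "nat set set" where
  "blowup_edges = {{a, b} | a b. a < 4 * n \<and> b < 4 * n \<and> a \<noteq> b \<and>
     (a div 4 = b div 4 \<or> S (a div 4) (b div 4) = 1)}"

lemma simple_blowup_edges: "simple_graph (4 * n) blowup_edges"
  by (auto simp: simple_graph_def blowup_edges_def)

lemma adj_mat_blowup_edges:
  assumes ab: "a < 4 * n" "b < 4 * n"
  shows "adj_mat (4 * n) blowup_edges $$ (a, b) =
    (1 + real_of_int (S (a div 4) (b div 4)) + (if a div 4 = b div 4 then 1 else 0)) / 2
      - (if a = b then 1 else 0)"
proof -
  have d: "a div 4 < n" "b div 4 < n" using ab by auto
  have "{a, b} \<in> blowup_edges \<longleftrightarrow> a \<noteq> b \<and> (a div 4 = b div 4 \<or> S (a div 4) (b div 4) = 1)"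
    using ab d S_sym by (auto simp: blowup_edges_def doubleton_eq_iff)
  thus ?thesis using ab d S_diag[of "a div 4"] S_off[OF d] by (auto simp: adj_mat_def)
qed

text \<open>The test vectors are constant on the copies of each point. For such a vector, coming from \<open>w\<close> in the eigenspace of
  \<open>S\<close> for \<open>q\<^sup>2\<close>, the matrix \<open>J\<close> contributes \<open>8 (\<Sum>u. w $ u)\<^sup>2 \<ge> 0\<close> to the quadratic form.\<close>
lemma blowup_graph_eigenvalue:
  "2 * real q ^ 2 + 1 \<le> graph_eigenvalue (4 * n) blowup_edges top_mult"
proof -
  let ?k = top_mult let ?N = "4 * n" let ?A = "adj_mat ?N blowup_edges"
  let ?c = "2 * real q ^ 2 + 1"
  obtain V where V: "V \<in> carrier_mat n ?k"
    and iso: "\<And>y. y \<in> carrier_vec ?k \<Longrightarrow> (V *\<^sub>v y) \<bullet> (V *\<^sub>v y) = y \<bullet> y"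
    and ev: "\<And>y. y \<in> carrier_vec ?k \<Longrightarrow> seidel_mat *\<^sub>v (V *\<^sub>v y) = real q ^ 2 \<cdot>\<^sub>v (V *\<^sub>v y)"
    using top_eigenspace by blast
  obtain U e where d: "orth_diag ?N ?A U e"
    using spectral_theorem_real_symmetric[OF adj_mat_carrier adj_mat_symmetric] by blast
  define Q where "Q = mat ?N ?k (\<lambda>(a, j). V $$ (a div 4, j))"
  have Q: "Q \<in> carrier_mat ?N ?k" by (simp add: Q_def)
  have "?k \<le> card {i. i < ?N \<and> ?c \<le> e i} + 0"
  proof (rule count_eigenvalues_ge[OF d Q])
    show "0\<^sub>m 0 ?k \<in> carrier_mat 0 ?k" by simp
    fix y :: "real vec" assume y: "y \<in> carrier_vec ?k" "y \<noteq> 0\<^sub>v ?k"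
    define w where "w = V *\<^sub>v y"
    define x where "x = Q *\<^sub>v y"
    have w: "w \<in> carrier_vec n" using V y by (simp add: w_def)
    have x: "x \<in> carrier_vec ?N" using Q y by (simp add: x_def)
    have xw: "x $ a = w $ (a div 4)" if "a < ?N" for a
      using that y(1) V by (simp add: x_def w_def Q_def scalar_prod_def)
    have ww: "w \<bullet> w > 0" using iso[OF y(1)] scalar_prod_self_pos[OF y(1,2)] by (simp add: w_def)
    have "x \<bullet> x = (\<Sum>a\<in>{0..<?N}. (\<lambda>u. w $ u * w $ u) (a div 4))"
      using x by (auto simp: scalar_prod_def xw intro!: sum.cong)
    also have "\<dots> = 4 * (w \<bullet> w)" using w sum_div_four[of "\<lambda>u. w $ u * w $ u" n] by (simp add: scalar_prod_def)
    finally have xx: "x \<bullet> x = 4 * (w \<bullet> w)" .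
    define F where "F = (\<lambda>u v. (w $ u * w $ v + real_of_int (S u v) * (w $ u * w $ v)
        + (if u = v then 1 else 0) * (w $ u * w $ v)) / 2)"
    have FF: "(\<Sum>a\<in>{0..<?N}. \<Sum>b\<in>{0..<?N}. F (a div 4) (b div 4)) = 16 * (\<Sum>u\<in>{0..<n}. \<Sum>v\<in>{0..<n}. F u v)"
    proof -
      have "(\<Sum>a\<in>{0..<?N}. \<Sum>b\<in>{0..<?N}. F (a div 4) (b div 4))
          = (\<Sum>a\<in>{0..<?N}. (\<lambda>u. 4 * (\<Sum>v\<in>{0..<n}. F u v)) (a div 4))"
        by (intro sum.cong refl sum_div_four)
      also have "\<dots> = 4 * (\<Sum>u\<in>{0..<n}. 4 * (\<Sum>v\<in>{0..<n}. F u v))" by (rule sum_div_four)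
      finally show ?thesis by (simp add: sum_distrib_left[symmetric])
    qed
    have "x \<bullet> (?A *\<^sub>v x) = (\<Sum>a\<in>{0..<?N}. \<Sum>b\<in>{0..<?N}. F (a div 4) (b div 4)
        - (if b = a then x $ a * x $ a else 0))"
      unfolding quadratic_form_sum[OF adj_mat_carrier x]
    proof (intro sum.cong refl)
      fix a b assume "a \<in> {0..<?N}" "b \<in> {0..<?N}"
      hence ab: "a < ?N" "b < ?N" by auto
      have distr: "((1 + s + c) / 2 - r) * p = (p + s * p + c * p) / 2 - r * p" for s c r p :: real
        by (simp add: algebra_simps add_divide_distrib)
      have diag: "(if a = b then 1 else 0) * (x $ a * x $ b) = (if b = a then x $ a * x $ a else 0)"
        by simp
      show "?A $$ (a, b) * (x $ a * x $ b) =
          F (a div 4) (b div 4) - (if b = a then x $ a * x $ a else 0)"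
        unfolding adj_mat_blowup_edges[OF ab] distr diag
        by (simp only: F_def xw[OF ab(1)] xw[OF ab(2)])
    qed
    also have "\<dots> = 16 * (\<Sum>u\<in>{0..<n}. \<Sum>v\<in>{0..<n}. F u v) - x \<bullet> x"
      unfolding sum_subtractf FF using x by (simp add: scalar_prod_def)
    also have "(\<Sum>u\<in>{0..<n}. \<Sum>v\<in>{0..<n}. F u v) =
        ((\<Sum>u\<in>{0..<n}. \<Sum>v\<in>{0..<n}. w $ u * w $ v) + real q ^ 2 * (w \<bullet> w) + w \<bullet> w) / 2"
      using seidel_mat_quadratic[OF w, of "real q ^ 2"] ev[OF y(1)] identity_quadratic[OF w]
      by (simp only: F_def sum_divide_distrib[symmetric] sum.distrib w_def)
    also have "(\<Sum>u\<in>{0..<n}. \<Sum>v\<in>{0..<n}. w $ u * w $ v) = (\<Sum>u\<in>{0..<n}. w $ u)\<^sup>2"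
      by (simp add: sum_product power2_eq_square)
    finally have "x \<bullet> (?A *\<^sub>v x) = 8 * (\<Sum>u\<in>{0..<n}. w $ u)\<^sup>2 + ?c * (x \<bullet> x)"
      unfolding xx by (simp add: algebra_simps)
    hence "?c * (x \<bullet> x) \<le> x \<bullet> (?A *\<^sub>v x)" by simp
    moreover have "x \<noteq> 0\<^sub>v ?N" using ww xx by auto
    ultimately show "Q *\<^sub>v y \<noteq> 0\<^sub>v ?N \<and> ?c * ((Q *\<^sub>v y) \<bullet> (Q *\<^sub>v y)) \<le> (Q *\<^sub>v y) \<bullet> (?A *\<^sub>v (Q *\<^sub>v y))"
      by (simp add: x_def)
  qed
  hence count: "?k \<le> length (filter (\<lambda>x. ?c \<le> x) (map e [0..<?N]))"
    unfolding card_eq_length_filter by simp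
  have "?c \<le> rev (sort (map e [0..<?N])) ! (?k - 1)"
    by (rule nth_largest_ge[OF refl _ _ count]) (use top_mult_le in auto)
  thus ?thesis unfolding graph_eigenvalue_orth_diag[OF d] .
qed

lemma eig_const_bounds:
  "(2 * real q ^ 2 + 1) / (4 * (real q ^ 3 + 1)) \<le> eig_const (int top_mult)"
  "(2 * real q ^ 2 + 1) / (4 * (real q ^ 3 + 1)) \<le> eig_const (- int top_mult + 1)"
proof -
  have rn: "real n = real q ^ 3 + 1" by (simp add: n)
  have "(2 * real q ^ 2 + 1) / (4 * (real q ^ 3 + 1))
      \<le> graph_eigenvalue (4 * n) blowup_edges top_mult / real (4 * n)"
    using blowup_graph_eigenvalue by (simp add: rn[symmetric] divide_right_mono)
  also have "\<dots> \<le> eig_const (int top_mult)"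
    by (rule eig_const_pos_ge[OF simple_blowup_edges]) (use top_mult_le in auto)
  finally show "(2 * real q ^ 2 + 1) / (4 * (real q ^ 3 + 1)) \<le> eig_const (int top_mult)" .
  let ?g = "graph_eigenvalue n neg_edges (n - (top_mult - 1) + 1)"
  have "(2 * real q ^ 2 + 1) / 4 \<le> \<bar>?g\<bar>" using neg_graph_eigenvalue by simp
  hence "(2 * real q ^ 2 + 1) / 4 / real n \<le> \<bar>?g\<bar> / real n"
    by (rule divide_right_mono) simp
  also have "\<dots> \<le> eig_const (- int (top_mult - 1))"
    by (rule eig_const_neg_ge[OF simple_neg_edges]) (use top_mult_le in auto)
  also have "- int (top_mult - 1) = - int top_mult + 1" using top_mult_le by simp
  finally show "(2 * real q ^ 2 + 1) / (4 * (real q ^ 3 + 1)) \<le> eig_const (- int top_mult + 1)"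
    by (simp add: rn)
qed

end

text \<open>With \<open>u = (2 q - 4) / (2 q\<^sup>2 + 1)\<close> the right-hand side is \<open>1 / (2 q - u)\<close>, so the claim is
  \<open>(2 q - 1 - u)\<^sup>2 < 4 (q\<^sup>2 - q) = (2 q - 1)\<^sup>2 - 1\<close>. As \<open>u\<close> is about \<open>1 / q\<close>, subtracting it lowers the square
  by about \<open>4\<close>, more than the required \<open>1\<close>.\<close>
lemma eigenvalue_ratio_exceeds:
  fixes q :: real
  assumes q: "q \<ge> 3"
  shows "1 / (2 * sqrt (q\<^sup>2 - q) + 1) < (2 * q\<^sup>2 + 1) / (4 * (q ^ 3 + 1))"
proof -
  define D where "D = 2 * q\<^sup>2 + 1"
  define u where "u = (2 * q - 4) / D"
  have D: "D > 0" by (simp add: D_def add_nonneg_pos)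
  have qq: "q\<^sup>2 \<ge> 3 * q" using q by (simp add: power2_eq_square)
  have u: "0 \<le> u" "u \<le> 1"
    using q qq D by (auto simp: u_def D_def)
  have Du: "D * u = 2 * q - 4" using D by (simp add: u_def)
  have eq: "4 * (q ^ 3 + 1) = D * (2 * q - u)"
    by (simp add: right_diff_distrib Du) (simp add: D_def power2_eq_square power3_eq_cube algebra_simps)
  have u8: "u \<le> 1 / 8"
  proof -
    have "0 \<le> 2 * (q - 4)\<^sup>2 + 1" by simp
    hence "8 * (2 * q - 4) \<le> D" by (simp add: D_def power2_eq_square algebra_simps)
    thus ?thesis using D by (simp add: u_def field_simps)
  qed
  have "2 * (2 * q - 1) * u > 1 + u\<^sup>2"
  proof -
    have "24 * q\<^sup>2 - 81 * q + 27 = (q - 3) * (24 * q - 9)"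
      by (simp add: power2_eq_square algebra_simps)
    also have "\<dots> \<ge> 0" using q by simp
    finally have "24 * q\<^sup>2 - 81 * q + 27 \<ge> 0" .
    moreover have e: "2 * (2 * q - 1) * (2 * q - 4) = 8 * q\<^sup>2 - 20 * q + 8"
      by (simp add: power2_eq_square algebra_simps)
    ultimately have a: "D + (2 * q - 4) / 8 < 2 * (2 * q - 1) * (2 * q - 4)"
      unfolding e D_def by (simp add: field_simps)
    have "(2 * q - 4) * u \<le> (2 * q - 4) / 8"
      using mult_left_mono[OF u8, of "2 * q - 4"] q by simp
    hence "D + (2 * q - 4) * u \<le> D + (2 * q - 4) / 8" by (rule add_left_mono)
    also note a
    finally have "D + (D * u) * u < 2 * (2 * q - 1) * (D * u)" unfolding Du .
    hence "D * (1 + u\<^sup>2) < D * (2 * (2 * q - 1) * u)"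
      by (simp add: power2_eq_square algebra_simps)
    thus ?thesis using D by simp
  qed
  moreover have "(2 * q - 1 - u)\<^sup>2 = 4 * (q\<^sup>2 - q) + 1 - 2 * (2 * q - 1) * u + u\<^sup>2"
    by (simp add: power2_eq_square algebra_simps)
  ultimately have "(2 * q - 1 - u)\<^sup>2 < 4 * (q\<^sup>2 - q)" by simp
  hence "2 * q - 1 - u < sqrt (4 * (q\<^sup>2 - q))" by (rule real_less_rsqrt)
  also have "\<dots> = 2 * sqrt (q\<^sup>2 - q)" by (simp only: real_sqrt_mult real_sqrt_four)
  finally have "2 * q - u < 2 * sqrt (q\<^sup>2 - q) + 1" by simp
  moreover have "2 * q - u > 0" using q u by simp
  ultimately have "1 / (2 * sqrt (q\<^sup>2 - q) + 1) < 1 / (2 * q - u)"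
    by (intro divide_strict_left_mono) auto
  also have "\<dots> = D / (4 * (q ^ 3 + 1))" unfolding eq using D by simp
  finally show ?thesis by (simp add: D_def)
qed

theorem theorem2p8:
  fixes q k :: nat
  assumes "primepow q" and "odd q" and "k = q\<^sup>2 - q + 1"
  shows "eig_const (int k) > 1 / (2 * sqrt (real k - 1) + 1) \<and>
         eig_const (- int k + 1) > 1 / (2 * sqrt (real k - 1) + 1)"
proof -
  have q1: "q > 1" using primepow_gt_Suc_0[OF assms(1)] by simp
  hence q3: "q \<ge> 3" using assms(2) by (cases "q = 2") auto
  obtain S where "unitary_seidel_matrix q (q ^ 3 + 1) S"
    using unitary_seidel_matrix_exists[OF assms(1,2)] by blast
  then interpret unitary_seidel_matrix q "q ^ 3 + 1" S .
  have k: "k = top_mult" by (simp add: assms(3) top_mult_def)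
  have "q \<le> q\<^sup>2" by (simp add: power2_eq_square)
  hence "real k - 1 = (real q)\<^sup>2 - real q" by (simp add: assms(3) of_nat_diff)
  hence "1 / (2 * sqrt (real k - 1) + 1) < (2 * real q ^ 2 + 1) / (4 * (real q ^ 3 + 1))"
    using eigenvalue_ratio_exceeds[of "real q"] q3 by simp
  thus ?thesis using eig_const_bounds unfolding k by linarith
qed

end
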